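(* Let $A,B\in\mathcal M_n$ be accretive with $W(A),W(B)\subset S_\alpha$ for some $0\le\alpha<\pi/2$. Then for every unitarily invariant norm $\|\cdot\|$ on $\mathcal M_n$ and every $f\in\mathfrak m$, $$\|A\sigma_fB\|\le\sec^3(\alpha)\,\big(\|A\|\,\sigma_f\,\|B\|\big),$$ where for positive scalars $a,b$, $a\sigma_fb=a\,f(b/a)$.
   Context: A matrix $A$ is accretive if $\Re A=\frac{A+A^*}{2}$ is positive definite. $W(A)$ is the numerical range, $S_\alpha=\{z:\Re z>0,\ |\Im z|\le\tan(\alpha)\Re z\}$. A norm is unitarily invariant if $\|UXV\|=\|X\|$ for all unitary $U,V$. $\mathfrak m$ is the set of matrix monotone $f:(0,\infty)\to(0,\infty)$ with $f(1)=1$; each has a unique probability measure $\nu_f$ on $[0,1]$ with $f(x)=\int_0^1((1-t)+tx^{-1})^{-1}d\nu_f(t)$, $x>0$. For accretive $A,B$: $A!_tB=((1-t)A^{-1}+tB^{-1})^{-1}$ and $A\sigma_fB:=\int_0^1A!_tB\,d\nu_f(t)$. *)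

theory Defs
  imports "HOL-Probability.Probability" "Jordan_Normal_Form.Schur_Decomposition"
begin

definition hermitian_mat :: "nat \<Rightarrow> complex mat \<Rightarrow> bool" where
  "hermitian_mat n A \<longleftrightarrow> A \<in> carrier_mat n n \<and> mat_adjoint A = A"

(* x^* A x ; note (v \<bullet>c w) = sum_i v_i * cnj (w_i) *)
definition qform :: "complex mat \<Rightarrow> complex vec \<Rightarrow> complex" where
  "qform A x = (A *\<^sub>v x) \<bullet>c x"

definition pos_def_mat :: "nat \<Rightarrow> complex mat \<Rightarrow> bool" where
  "pos_def_mat n A \<longleftrightarrow> hermitian_mat n A \<and>
     (\<forall>x \<in> carrier_vec n. x \<noteq> 0\<^sub>v n \<longrightarrow> Re (qform A x) > 0)"

definition pos_semidef_mat :: "nat \<Rightarrow> complex mat \<Rightarrow> bool" where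
  "pos_semidef_mat n A \<longleftrightarrow> hermitian_mat n A \<and>
     (\<forall>x \<in> carrier_vec n. Re (qform A x) \<ge> 0)"

definition loewner_le :: "nat \<Rightarrow> complex mat \<Rightarrow> complex mat \<Rightarrow> bool" where
  "loewner_le n A B \<longleftrightarrow> hermitian_mat n A \<and> hermitian_mat n B \<and> pos_semidef_mat n (B - A)"

definition unitary_mat :: "nat \<Rightarrow> complex mat \<Rightarrow> bool" where
  "unitary_mat n U \<longleftrightarrow> U \<in> carrier_mat n n \<and> mat_adjoint U * U = 1\<^sub>m n \<and> U * mat_adjoint U = 1\<^sub>m n"

definition udiag :: "nat \<Rightarrow> complex mat \<Rightarrow> (nat \<Rightarrow> real) \<Rightarrow> complex mat" where
  "udiag n U d = U * mat_diag n (\<lambda>i. complex_of_real (d i)) * mat_adjoint U"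

(* matrix monotone on (0,oo): for all sizes n and positive definite A <= B,
   f(A) <= f(B), where f(A) = U diag(f(lambda_i)) U^* for a spectral decomposition
   A = U diag(lambda_i) U^* (lambda_i > 0 the eigenvalues). *)
definition matrix_monotone :: "(real \<Rightarrow> real) \<Rightarrow> bool" where
  "matrix_monotone f \<longleftrightarrow>
    (\<forall>n U V l m. unitary_mat n U \<and> unitary_mat n V \<and>
        (\<forall>i<n. l i > 0) \<and> (\<forall>i<n. m i > 0) \<and>
        loewner_le n (udiag n U l) (udiag n V m) \<longrightarrow>
        loewner_le n (udiag n U (f \<circ> l)) (udiag n V (f \<circ> m)))"

definition class_m :: "(real \<Rightarrow> real) set" where
  "class_m = {f. (\<forall>x>0. f x > 0) \<and> f 1 = 1 \<and> matrix_monotone f}"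

definition represents :: "real measure \<Rightarrow> (real \<Rightarrow> real) \<Rightarrow> bool" where
  "represents \<nu> f \<longleftrightarrow> prob_space \<nu> \<and> sets \<nu> = sets (restrict_space borel {0..1::real}) \<and>
     (\<forall>x>0. f x = (\<integral>t. inverse ((1 - t) + t * inverse x) \<partial>\<nu>))"

definition accretive :: "nat \<Rightarrow> complex mat \<Rightarrow> bool" where
  "accretive n A \<longleftrightarrow> A \<in> carrier_mat n n \<and> pos_def_mat n ((1/2) \<cdot>\<^sub>m (A + mat_adjoint A))"

definition num_range :: "nat \<Rightarrow> complex mat \<Rightarrow> complex set" where
  "num_range n A = {qform A x | x. x \<in> carrier_vec n \<and> x \<bullet>c x = 1}"

definition sector :: "real \<Rightarrow> complex set" where
  "sector \<alpha> = {z. Re z > 0 \<and> \<bar>Im z\<bar> \<le> tan \<alpha> * Re z}"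

definition unitarily_invariant_norm :: "nat \<Rightarrow> (complex mat \<Rightarrow> real) \<Rightarrow> bool" where
  "unitarily_invariant_norm n N \<longleftrightarrow>
     (\<forall>X \<in> carrier_mat n n. N X \<ge> 0 \<and> (N X = 0 \<longleftrightarrow> X = 0\<^sub>m n n)) \<and>
     (\<forall>c. \<forall>X \<in> carrier_mat n n. N (c \<cdot>\<^sub>m X) = cmod c * N X) \<and>
     (\<forall>X \<in> carrier_mat n n. \<forall>Y \<in> carrier_mat n n. N (X + Y) \<le> N X + N Y) \<and>
     (\<forall>U V X. unitary_mat n U \<and> unitary_mat n V \<and> X \<in> carrier_mat n n \<longrightarrow> N (U * X * V) = N X)"

definition cinv :: "nat \<Rightarrow> complex mat \<Rightarrow> complex mat" where
  "cinv n A = (SOME B. B \<in> carrier_mat n n \<and> A * B = 1\<^sub>m n \<and> B * A = 1\<^sub>m n)"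

definition wharm :: "nat \<Rightarrow> real \<Rightarrow> complex mat \<Rightarrow> complex mat \<Rightarrow> complex mat" where
  "wharm n t A B = cinv n (complex_of_real (1 - t) \<cdot>\<^sub>m cinv n A + complex_of_real t \<cdot>\<^sub>m cinv n B)"

(* A \<sigma>_f B = \<integral> A !_t B d\<nu>_f(t), integral taken entrywise *)
definition msigma :: "nat \<Rightarrow> real measure \<Rightarrow> complex mat \<Rightarrow> complex mat \<Rightarrow> complex mat" where
  "msigma n \<nu> A B = mat n n (\<lambda>(i,j). \<integral>t. (wharm n t A B) $$ (i,j) \<partial>\<nu>)"

definition ssigma :: "(real \<Rightarrow> real) \<Rightarrow> real \<Rightarrow> real \<Rightarrow> real" where
  "ssigma f a b = a * f (b / a)"

end

(* Writing M = A \<sigma>_f B = U diag(d) V^* with unitary U, V and columns u_i, v_i, one has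
   d_i = <M v_i, u_i>, so N M is controlled by the sesquilinear form of M: if |d_i| is bounded by
   diagonal entries of unitary conjugates of A and B, then N M is bounded by N A and N B, because
   a unitarily invariant norm decreases under passing to the diagonal and is monotone on diagonal
   matrices. The form of M is the integral of the forms of H = A !_t B. As H is sectorial,
   |<H v, u>| <= sec(\<alpha>) (Re <H v, v> + Re <H u, u>) / 2, and the same inequality applied to A and B
   gives Re H <= sec(\<alpha>)^2 (s^2/(1-t) Re A + (1-s)^2/t Re B) for each s. The optimal s for the scalars
   a = N A, b = N B turns the resulting bound on N M into sec(\<alpha>)^3 times the integral of a !_t b. *)

theory Submission
  imports Defs "Jordan_Normal_Form.Spectral_Radius"
begin

no_notation inner (infix "\<bullet>" 70)
no_notation vec_nth (infixl "$" 90)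

section \<open>Adjoints and unitary matrices\<close>

text \<open>Since M is not Hermitian, its left and right singular vectors differ, so every estimate
  carries forms at both u and v; the resulting factor 2 cancels the 1/2 in the sectorial
  Cauchy-Schwarz inequality. The cube is one secant from that inequality for H, used to pass from
  \<open><H v, u>\<close> to real parts, times two secants from applying it to A and B, where the
  secant is moved into the vector and comes back squared.

  Optimising s separately for each vector would give coefficients that depend on u and v, and the
  forms of A and B could not be pulled out of the integral. The chosen s depends only on t, a and b.
  Integrating over t therefore leaves two numbers P and Q that serve all pairs of singular vectors
  at once. Only scalar functions are integrated, and N is applied once, to the finished mean, so no
  integral of matrices ever has to be compared with N.

  The diagonal d may be complex, because N sees only moduli on diagonal matrices. The decomposition
  is established for nonsingular matrices; M qualifies because the real part of its form is strictly
  positive on nonzero vectors.\<close>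

lemma mat_adjoint_carrier [simp]:
  "A \<in> carrier_mat n m \<Longrightarrow> mat_adjoint A \<in> carrier_mat m n"
  by (auto simp: mat_adjoint_def)

lemma mat_adjoint_dim [simp]:
  "dim_row (mat_adjoint A) = dim_col A" "dim_col (mat_adjoint A) = dim_row A"
  by (auto simp: mat_adjoint_def)

lemma mat_adjoint_index [simp]:
  fixes A :: "complex mat"
  shows "i < dim_col A \<Longrightarrow> j < dim_row A \<Longrightarrow> mat_adjoint A $$ (i, j) = cnj (A $$ (j, i))"
  by (simp add: mat_adjoint_def mat_of_rows_def)

lemma mat_adjoint_adjoint [simp]: "mat_adjoint (mat_adjoint A) = (A :: complex mat)"
  by (rule eq_matI) auto

lemma mat_adjoint_mult:
  fixes A B :: "complex mat"
  assumes "A \<in> carrier_mat n m" "B \<in> carrier_mat m k"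
  shows "mat_adjoint (A * B) = mat_adjoint B * mat_adjoint A"
  using assms by (intro eq_matI) (auto simp: scalar_prod_def mult.commute)

lemma cinner_mult_mat_vec_sum:
  fixes X :: "complex mat"
  assumes "X \<in> carrier_mat n m" "v \<in> carrier_vec m" "u \<in> carrier_vec n"
  shows "(X *\<^sub>v v) \<bullet>c u = (\<Sum>i<n. \<Sum>j<m. X $$ (i, j) * (v $ j * cnj (u $ i)))"
  using assms
  by (auto simp: scalar_prod_def sum_distrib_right mult.assoc lessThan_atLeast0 intro!: sum.cong)

lemma cinner_mult_mat_vec:
  fixes A :: "complex mat"
  assumes "A \<in> carrier_mat n m" "x \<in> carrier_vec m" "y \<in> carrier_vec n"
  shows "(A *\<^sub>v x) \<bullet>c y = x \<bullet>c (mat_adjoint A *\<^sub>v y)"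
proof -
  have "(A *\<^sub>v x) \<bullet>c y = (\<Sum>j<m. \<Sum>i<n. A $$ (i,j) * (x $ j * cnj (y $ i)))"
    unfolding cinner_mult_mat_vec_sum[OF assms] by (rule sum.swap)
  also have "\<dots> = x \<bullet>c (mat_adjoint A *\<^sub>v y)"
    using assms by (auto simp: scalar_prod_def sum_distrib_left lessThan_atLeast0 ac_simps
        intro!: sum.cong)
  finally show ?thesis .
qed

lemma cinner_commute:
  fixes x y :: "complex vec"
  assumes "x \<in> carrier_vec n" "y \<in> carrier_vec n"
  shows "y \<bullet>c x = cnj (x \<bullet>c y)"
  using assms by (auto simp: scalar_prod_def mult.commute)

lemma cinner_self:
  fixes v :: "complex vec"
  shows "v \<bullet>c v = complex_of_real (\<Sum>i<dim_vec v. (cmod (v $ i))\<^sup>2)"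
  unfolding scalar_prod_def of_real_sum
  by (auto simp: lessThan_atLeast0 complex_norm_square simp del: of_real_power intro!: sum.cong)

lemma cinner_self_pos:
  fixes v :: "complex vec"
  assumes "v \<in> carrier_vec n" "v \<noteq> 0\<^sub>v n"
  shows "\<exists>r>0. v \<bullet>c v = complex_of_real r"
proof -
  let ?r = "\<Sum>i<dim_vec v. (cmod (v $ i))\<^sup>2"
  have "?r \<noteq> 0"
  proof
    assume "?r = 0"
    then have "v \<bullet>c v = 0" unfolding cinner_self by simp
    then show False using assms conjugate_square_eq_0_vec[OF assms(1)] by simp
  qed
  moreover have "?r \<ge> 0" by (simp add: sum_nonneg)
  ultimately show ?thesis using cinner_self[of v] by (intro exI[of _ ?r]) auto
qed

lemma cinner_smult:
  fixes x y :: "complex vec"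
  assumes "x \<in> carrier_vec n" "y \<in> carrier_vec n"
  shows "(c \<cdot>\<^sub>v x) \<bullet>c y = c * (x \<bullet>c y)" "x \<bullet>c (c \<cdot>\<^sub>v y) = cnj c * (x \<bullet>c y)"
  using assms by (auto simp: conjugate_smult_vec)

lemma cinner_add:
  fixes x y z :: "complex vec"
  assumes "x \<in> carrier_vec n" "y \<in> carrier_vec n" "z \<in> carrier_vec n"
  shows "(x + y) \<bullet>c z = x \<bullet>c z + y \<bullet>c z" "z \<bullet>c (x + y) = z \<bullet>c x + z \<bullet>c y"
  using assms
  by (auto simp: conjugate_add_vec[of _ n] add_scalar_prod_distrib[of _ n]
      scalar_prod_add_distrib[of _ n])

lemma unitary_matI:
  assumes "U \<in> carrier_mat n n" "mat_adjoint U * U = 1\<^sub>m n"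
  shows "unitary_mat n U"
  using assms mat_mult_left_right_inverse[of "mat_adjoint U" n U] by (auto simp: unitary_mat_def)

lemma unitary_mat_adjoint: "unitary_mat n U \<Longrightarrow> unitary_mat n (mat_adjoint U)"
  by (auto simp: unitary_mat_def)

lemma unitary_mat_mult:
  assumes "unitary_mat n U" "unitary_mat n V"
  shows "unitary_mat n (U * V)"
proof (rule unitary_matI)
  have U: "U \<in> carrier_mat n n" "mat_adjoint U * U = 1\<^sub>m n"
    and V: "V \<in> carrier_mat n n" "mat_adjoint V * V = 1\<^sub>m n"
    using assms by (auto simp: unitary_mat_def)
  show "U * V \<in> carrier_mat n n" using U V by auto
  have "mat_adjoint (U * V) * (U * V) = mat_adjoint V * (mat_adjoint U * (U * V))"
    using U V mat_adjoint_carrier[OF U(1)] mat_adjoint_carrier[OF V(1)]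
    by (simp add: mat_adjoint_mult[of _ n n _ n] assoc_mult_mat[of _ n n _ n _ n])
  also have "mat_adjoint U * (U * V) = mat_adjoint U * U * V"
    by (rule assoc_mult_mat[symmetric]) (use U V in auto)
  also have "mat_adjoint V * (mat_adjoint U * U * V) = 1\<^sub>m n" using U V by simp
  finally show "mat_adjoint (U * V) * (U * V) = 1\<^sub>m n" .
qed

lemma adjoint_mult_index:
  fixes U V :: "complex mat"
  assumes "U \<in> carrier_mat n n" "V \<in> carrier_mat n n" "i < n" "j < n"
  shows "(mat_adjoint U * V) $$ (i, j) = col V j \<bullet>c col U i"
proof -
  have "(mat_adjoint U * V) $$ (i, j) = row (mat_adjoint U) i \<bullet> col V j"
    using assms by simp
  also have "row (mat_adjoint U) i = conjugate (col U i)"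
    using assms by (intro eq_vecI) auto
  also have "conjugate (col U i) \<bullet> col V j = col V j \<bullet>c col U i"
    using assms by (intro comm_scalar_prod[of _ n]) auto
  finally show ?thesis .
qed

lemma adjoint_mult_mult_index:
  fixes U V M :: "complex mat"
  assumes "U \<in> carrier_mat n n" "V \<in> carrier_mat n n" "M \<in> carrier_mat n n" "i < n" "j < n"
  shows "(mat_adjoint U * M * V) $$ (i, j) = (M *\<^sub>v col V j) \<bullet>c col U i"
proof -
  have "mat_adjoint U * M * V = mat_adjoint U * (M * V)"
    by (rule assoc_mult_mat) (use assms in auto)
  moreover have "col (M * V) j = M *\<^sub>v col V j"
    by (rule col_mult2) (use assms in auto)
  ultimately show ?thesis
    using assms adjoint_mult_index[of U n "M * V" i j] by (metis mult_carrier_mat)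
qed

lemma unitary_mat_col_inner:
  assumes "unitary_mat n U" "i < n" "j < n"
  shows "col U j \<bullet>c col U i = (if i = j then 1 else 0)"
  using adjoint_mult_index[of U n U i j] assms unfolding unitary_mat_def
  by (metis index_one_mat(1))

text \<open>Gram-Schmidt applied to a basis completion of \<open>v\<close> gives orthogonal,
  unnormalised vectors and leaves the head equal to \<open>v\<close>. Dividing each by its length
  makes them the columns of a unitary matrix, so \<open>c\<close> is the reciprocal of the length of
  \<open>v\<close>.\<close>

lemma exists_unitary_first_col:
  fixes v :: "complex vec"
  assumes v: "v \<in> carrier_vec n" "v \<noteq> 0\<^sub>v n"
  shows "\<exists>W c. unitary_mat n W \<and> c > 0 \<and> col W 0 = complex_of_real c \<cdot>\<^sub>v v"
proof -
  interpret cof_vec_space n "TYPE(complex)" .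
  define b where "b = basis_completion v"
  define ws where "ws = gram_schmidt n b"
  have n: "n > 0" using v by (cases n) auto
  from basis_completion[OF v, folded b_def]
  have span_b: "span (set b) = carrier_vec n" and dist_b: "distinct b"
    and indep: "\<not> lin_dep (set b)" and b: "set b \<subseteq> carrier_vec n" and hdb: "hd b = v"
    and len_b: "length b = n" by auto
  from hdb len_b n obtain vs where bv: "b = v # vs" by (cases b, auto)
  from gram_schmidt_result[OF b dist_b indep refl, folded ws_def]
  have ws: "set ws \<subseteq> carrier_vec n" "corthogonal ws" "length ws = n"
    by (auto simp: len_b)
  from gram_schmidt_hd[OF v(1), of vs, folded bv] have hdws: "hd ws = v" unfolding ws_def .
  have wsi: "ws ! i \<in> carrier_vec n" if "i < n" for i using ws that by auto
  have orth: "ws ! i \<bullet>c ws ! j = 0 \<longleftrightarrow> i \<noteq> j" if "i < n" "j < n" for i j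
    using corthogonalD[OF ws(2)] that ws(3) by auto
  define r where "r i = Re (ws ! i \<bullet>c ws ! i)" for i
  have r: "r i > 0" "ws ! i \<bullet>c ws ! i = complex_of_real (r i)" if "i < n" for i
    using cinner_self_pos[OF wsi[OF that]] orth[OF that that] wsi[OF that] unfolding r_def by auto
  define W where "W = mat_of_cols n (map (\<lambda>w. complex_of_real (1 / sqrt (Re (w \<bullet>c w))) \<cdot>\<^sub>v w) ws)"
  have W: "W \<in> carrier_mat n n" using ws(3) unfolding W_def by auto
  have colW: "col W i = complex_of_real (1 / sqrt (r i)) \<cdot>\<^sub>v ws ! i" if "i < n" for i
    using that ws(3) wsi[OF that] unfolding W_def r_def by (subst col_mat_of_cols) auto
  have "mat_adjoint W * W = 1\<^sub>m n"
  proof (rule eq_matI)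
    fix i j assume "i < dim_row (1\<^sub>m n :: complex mat)" "j < dim_col (1\<^sub>m n :: complex mat)"
    hence ij: "i < n" "j < n" by auto
    have "(mat_adjoint W * W) $$ (i, j) = col W j \<bullet>c col W i"
      using adjoint_mult_index[OF W W ij] .
    also have "\<dots> = complex_of_real (1 / sqrt (r j)) * complex_of_real (1 / sqrt (r i)) * (ws ! j \<bullet>c ws ! i)"
      using ij wsi by (simp add: colW cinner_smult[of _ n])
    also have "\<dots> = (if i = j then 1 else 0)"
    proof (cases "i = j")
      case True
      have "1 / sqrt (r j) * (1 / sqrt (r j)) * r j = 1"
        using r[OF ij(2)] by (simp add: field_simps)
      then show ?thesis using True r[OF ij(2)]
        by (metis of_real_mult of_real_1)
    next
      case False
      then show ?thesis using orth[OF ij(2) ij(1)] by auto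
    qed
    finally show "(mat_adjoint W * W) $$ (i, j) = 1\<^sub>m n $$ (i, j)" using ij by simp
  qed (use W in auto)
  then have "unitary_mat n W" using W by (rule unitary_matI[rotated])
  moreover have "col W 0 = complex_of_real (1 / sqrt (r 0)) \<cdot>\<^sub>v v"
    using colW[OF n] hdws ws(3) n by (cases ws) auto
  moreover have "1 / sqrt (r 0) > 0" using r[OF n] by simp
  ultimately show ?thesis by blast
qed

section \<open>Singular values\<close>

lemma mat_adjoint_four_block:
  fixes A B C D :: "complex mat"
  assumes "A \<in> carrier_mat n1 m1" "B \<in> carrier_mat n1 m2"
    "C \<in> carrier_mat n2 m1" "D \<in> carrier_mat n2 m2"
  shows "mat_adjoint (four_block_mat A B C D)
    = four_block_mat (mat_adjoint A) (mat_adjoint C) (mat_adjoint B) (mat_adjoint D)"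
  using assms by (intro eq_matI) auto

lemma mat_adjoint_one [simp]: "mat_adjoint (1\<^sub>m n) = (1\<^sub>m n :: complex mat)"
  by (rule eq_matI) auto

lemma mat_adjoint_zero [simp]: "mat_adjoint (0\<^sub>m n m) = (0\<^sub>m m n :: complex mat)"
  by (rule eq_matI) auto

lemma block_diag_mult:
  fixes A1 A2 D1 D2 :: "complex mat"
  assumes "A1 \<in> carrier_mat m m" "D1 \<in> carrier_mat n n" "A2 \<in> carrier_mat m m" "D2 \<in> carrier_mat n n"
  shows "four_block_mat A1 (0\<^sub>m m n) (0\<^sub>m n m) D1 * four_block_mat A2 (0\<^sub>m m n) (0\<^sub>m n m) D2
    = four_block_mat (A1 * A2) (0\<^sub>m m n) (0\<^sub>m n m) (D1 * D2)"
  using assms by (subst mult_four_block_mat[of _ m m _ n _ n]) auto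

lemma unitary_block:
  assumes "unitary_mat n U"
  shows "unitary_mat (Suc n) (four_block_mat (1\<^sub>m 1) (0\<^sub>m 1 n) (0\<^sub>m n 1) U)"
proof (rule unitary_matI)
  have U: "U \<in> carrier_mat n n" "mat_adjoint U * U = 1\<^sub>m n"
    using assms by (auto simp: unitary_mat_def)
  show "four_block_mat (1\<^sub>m 1) (0\<^sub>m 1 n) (0\<^sub>m n 1) U \<in> carrier_mat (Suc n) (Suc n)"
    using U by (auto intro!: carrier_matI)
  show "mat_adjoint (four_block_mat (1\<^sub>m 1) (0\<^sub>m 1 n) (0\<^sub>m n 1) U)
      * four_block_mat (1\<^sub>m 1) (0\<^sub>m 1 n) (0\<^sub>m n 1) U = 1\<^sub>m (Suc n)"
    using U by (simp add: mat_adjoint_four_block[of _ 1 1 _ n _ n] block_diag_mult)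
qed

lemma unitary_det_nonzero:
  assumes "unitary_mat n U"
  shows "Determinant.det U \<noteq> 0"
proof -
  have "Determinant.det (mat_adjoint U) * Determinant.det U = 1"
    using assms det_mult[of "mat_adjoint U" n U] by (auto simp: unitary_mat_def)
  then show ?thesis by auto
qed

text \<open>Deflation: for an eigenvector \<open>v\<close> of \<open>M^* M\<close>, take unitary
  \<open>W\<close> and \<open>X\<close> whose first columns are multiples of \<open>v\<close> and
  \<open>M v\<close>. Then \<open>X^* M W\<close> splits into a corner entry and a smaller block.
  Nonsingularity ensures that \<open>M v\<close> is nonzero and is inherited by the block through
  the determinant.\<close>

lemma singular_value_decomposition:
  fixes M :: "complex mat"
  assumes "M \<in> carrier_mat n n" "Determinant.det M \<noteq> 0"
  shows "\<exists>U V d. unitary_mat n U \<and> unitary_mat n V \<and> mat_adjoint U * M * V = mat_diag n d"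
  using assms
proof (induction n arbitrary: M)
  case 0
  have "unitary_mat 0 (1\<^sub>m 0)" by (auto simp: unitary_mat_def)
  moreover have "mat_adjoint (1\<^sub>m 0) * M * 1\<^sub>m 0 = mat_diag 0 (\<lambda>_. 0)"
    using 0 by (intro eq_matI) (auto simp: mat_diag_def)
  ultimately show ?case by blast
next
  case (Suc n M)
  let ?n = "Suc n"
  note M = Suc.prems(1)
  have H: "mat_adjoint M * M \<in> carrier_mat ?n ?n" using M mat_adjoint_carrier[OF M] by auto
  obtain e where "eigenvalue (mat_adjoint M * M) e"
    using spectrum_non_empty[OF H] by (auto simp: spectrum_def)
  then obtain v where v: "v \<in> carrier_vec ?n" "v \<noteq> 0\<^sub>v ?n" "mat_adjoint M * M *\<^sub>v v = e \<cdot>\<^sub>v v"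
    using H M by (auto simp: eigenvalue_def eigenvector_def)
  have Mv: "M *\<^sub>v v \<in> carrier_vec ?n" "M *\<^sub>v v \<noteq> 0\<^sub>v ?n"
    using det_0_iff_vec_prod_zero_field[OF M] Suc.prems(2) M v by auto
  obtain W c where W: "unitary_mat ?n W" "c > 0" "col W 0 = complex_of_real c \<cdot>\<^sub>v v"
    using exists_unitary_first_col[OF v(1,2)] by blast
  obtain X b where X: "unitary_mat ?n X" "b > 0" "col X 0 = complex_of_real b \<cdot>\<^sub>v (M *\<^sub>v v)"
    using exists_unitary_first_col[OF Mv] by blast
  have Wc: "W \<in> carrier_mat ?n ?n" and Xc: "X \<in> carrier_mat ?n ?n"
    using W X by (auto simp: unitary_mat_def)
  define K where "K = mat_adjoint X * M * W"
  have Kc: "K \<in> carrier_mat ?n ?n" unfolding K_def using M Wc mat_adjoint_carrier[OF Xc] by auto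
  have Ki: "K $$ (i, j) = (M *\<^sub>v col W j) \<bullet>c col X i" if "i < ?n" "j < ?n" for i j
    unfolding K_def by (rule adjoint_mult_mult_index[OF Xc Wc M that])
  have colW: "col W j \<in> carrier_vec ?n" and colX: "col X j \<in> carrier_vec ?n" for j
    using Wc Xc by (auto simp: col_def)
  \<comment> \<open>\<open>M v\<close> spans the same line as the first column of \<open>X\<close>,
    hence is orthogonal to the other columns. The factor \<open>b\<close> is inserted to make that
    first column appear literally.\<close>
  have col0: "K $$ (i, 0) = 0" if i: "i < ?n" "i \<noteq> 0" for i
  proof -
    have "complex_of_real b * K $$ (i, 0) = complex_of_real b * (complex_of_real c * ((M *\<^sub>v v) \<bullet>c col X i))"
      using i v Mv colX[of i] W(3) M
      by (simp add: Ki mult_mat_vec[of _ ?n ?n] cinner_smult[of _ ?n])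
    also have "\<dots> = complex_of_real c * (col X 0 \<bullet>c col X i)"
      using Mv colX[of i] by (simp add: X(3) cinner_smult[of _ ?n])
    also have "\<dots> = 0" using unitary_mat_col_inner[OF X(1) i(1), of 0] i by simp
    finally show ?thesis using X(2) by simp
  qed
  \<comment> \<open>The eigenvector equation enters here: moving \<open>M\<close> to the other side
    turns \<open>M v\<close> into \<open>e v\<close>, which is orthogonal to the remaining columns
    of \<open>W\<close>.\<close>
  have row0: "K $$ (0, j) = 0" if j: "j < ?n" "j \<noteq> 0" for j
  proof -
    have "K $$ (0, j) = complex_of_real b * (col W j \<bullet>c (mat_adjoint M *\<^sub>v (M *\<^sub>v v)))"
      using j Mv M colW[of j] mult_mat_vec_carrier[OF M colW[of j]]
        cinner_mult_mat_vec[OF M colW[of j] Mv(1)]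
      by (simp add: Ki X(3) cinner_smult[of _ ?n])
    also have "mat_adjoint M *\<^sub>v (M *\<^sub>v v) = e \<cdot>\<^sub>v v"
      using v(3) assoc_mult_mat_vec[OF mat_adjoint_carrier[OF M] M v(1)] by simp
    finally have "complex_of_real c * K $$ (0, j)
        = complex_of_real b * cnj e * (col W j \<bullet>c col W 0)"
      using colW[of j] v by (simp add: W(3) cinner_smult[of _ ?n])
    also have "\<dots> = 0" using unitary_mat_col_inner[OF W(1) _ j(1), of 0] j by simp
    finally show ?thesis using W(2) by simp
  qed
  obtain S K2 K3 M' where sp: "split_block K 1 1 = (S, K2, K3, M')"
    by (cases "split_block K 1 1") auto
  have "dim_row K = 1 + n" "dim_col K = 1 + n" using Kc by auto
  note spl = split_block[OF sp this]
  have K2: "K2 = 0\<^sub>m 1 n"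
    using sp row0 Kc unfolding split_block_def Let_def by (intro eq_matI) auto
  have K3: "K3 = 0\<^sub>m n 1"
    using sp col0 Kc unfolding split_block_def Let_def by (intro eq_matI) auto
  have K: "K = four_block_mat S (0\<^sub>m 1 n) (0\<^sub>m n 1) M'" using spl(5) K2 K3 by simp
  have "Determinant.det K = Determinant.det (mat_adjoint X) * Determinant.det M * Determinant.det W"
    unfolding K_def using M Wc mat_adjoint_carrier[OF Xc] by (simp add: det_mult[of _ ?n])
  also have "\<dots> \<noteq> 0"
    using Suc.prems unitary_det_nonzero[OF W(1)] unitary_det_nonzero[OF unitary_mat_adjoint[OF X(1)]]
    by simp
  finally have "Determinant.det M' \<noteq> 0"
    unfolding K using det_four_block_mat_upper_right_zero[OF spl(1) refl _ spl(4)] by auto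
  from Suc.IH[OF spl(4) this] obtain U' V' d' where
    U': "unitary_mat n U'" and V': "unitary_mat n V'" and d': "mat_adjoint U' * M' * V' = mat_diag n d'"
    by blast
  let ?B = "\<lambda>U. four_block_mat (1\<^sub>m 1) (0\<^sub>m 1 n) (0\<^sub>m n 1) U :: complex mat"
  have U'c: "U' \<in> carrier_mat n n" and V'c: "V' \<in> carrier_mat n n"
    using U' V' by (auto simp: unitary_mat_def)
  have BU: "unitary_mat ?n (?B U')" and BV: "unitary_mat ?n (?B V')"
    using unitary_block U' V' by auto
  have BUc: "?B U' \<in> carrier_mat ?n ?n" and BVc: "?B V' \<in> carrier_mat ?n ?n"
    using BU BV by (auto simp: unitary_mat_def)
  have "mat_adjoint (X * ?B U') * M * (W * ?B V') = mat_adjoint (?B U') * K * ?B V'"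
  proof -
    have aX: "mat_adjoint X \<in> carrier_mat ?n ?n" and aB: "mat_adjoint (?B U') \<in> carrier_mat ?n ?n"
      using Xc BUc by auto
    have "mat_adjoint (X * ?B U') * M * (W * ?B V')
        = mat_adjoint (?B U') * mat_adjoint X * M * (W * ?B V')"
      by (simp only: mat_adjoint_mult[OF Xc BUc])
    also have "\<dots> = mat_adjoint (?B U') * mat_adjoint X * M * W * ?B V'"
      by (rule assoc_mult_mat[symmetric, of _ ?n ?n _ ?n _ ?n])
        (intro mult_carrier_mat[of _ ?n ?n] aX aB M Wc BVc)+
    also have "mat_adjoint (?B U') * mat_adjoint X * M * W
        = mat_adjoint (?B U') * (mat_adjoint X * M * W)"
      by (simp only: assoc_mult_mat[OF aB aX M] assoc_mult_mat[OF aB mult_carrier_mat[OF aX M] Wc])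
    finally show ?thesis unfolding K_def .
  qed
  also have "mat_adjoint (?B U') = ?B (mat_adjoint U')"
    using U'c by (simp add: mat_adjoint_four_block[of _ 1 1 _ n _ n])
  also have "?B (mat_adjoint U') * K = four_block_mat S (0\<^sub>m 1 n) (0\<^sub>m n 1) (mat_adjoint U' * M')"
    unfolding K using spl U'c by (simp add: block_diag_mult)
  also have "\<dots> * ?B V' = four_block_mat S (0\<^sub>m 1 n) (0\<^sub>m n 1) (mat_diag n d')"
    using spl U'c V'c mat_adjoint_carrier[OF U'c] d'
    by (subst block_diag_mult) auto
  also have "\<dots> = mat_diag ?n (case_nat (S $$ (0, 0)) d')"
    using spl(1) by (intro eq_matI) (auto simp: mat_diag_def split: nat.splits)
  finally show ?case
    using unitary_mat_mult[OF X(1) BU] unitary_mat_mult[OF W(1) BV] by blast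
qed

section \<open>Unitarily invariant norms\<close>

lemma cmod_square: "complex_of_real ((cmod c)\<^sup>2) = cnj c * c"
  by (simp only: complex_norm_square mult.commute)

lemma unitary_mat_diag:
  assumes "\<And>i. i < n \<Longrightarrow> cmod (e i) = 1"
  shows "unitary_mat n (mat_diag n e)"
proof (rule unitary_matI)
  have "mat_adjoint (mat_diag n e) = mat_diag n (\<lambda>i. cnj (e i))"
    by (rule eq_matI) (auto simp: mat_diag_def)
  then have "mat_adjoint (mat_diag n e) * mat_diag n e = mat_diag n (\<lambda>i. cnj (e i) * e i)"
    by simp
  also have "\<dots> = 1\<^sub>m n"
    using assms by (intro eq_matI) (auto simp: mat_diag_def simp flip: cmod_square)
  finally show "mat_adjoint (mat_diag n e) * mat_diag n e = 1\<^sub>m n" .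
qed simp

text \<open>A real r in [0,1] is the midpoint of the unit-circle points r + i q and r - i q with q =
  sqrt(1 - r^2); multiplying by the phase of \<open>z\<close> gives the general case.\<close>

lemma unit_disc_average:
  assumes "cmod z \<le> 1"
  shows "\<exists>a b. cmod a = 1 \<and> cmod b = 1 \<and> z = (a + b) / 2"
proof -
  obtain e where e: "cmod e = 1" "z = complex_of_real (cmod z) * e"
  proof (cases "z = 0")
    case False
    then have "cmod (sgn z) = 1" by (simp add: norm_sgn)
    moreover have "z = complex_of_real (cmod z) * sgn z" using False by (simp add: sgn_eq)
    ultimately show ?thesis by (rule that)
  qed (use that[of 1] in auto)
  let ?r = "cmod z" and ?q = "sqrt (1 - (cmod z)\<^sup>2)"
  have q: "?r\<^sup>2 + ?q\<^sup>2 = 1" using assms by (simp add: power_le_one)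
  have "cmod (Complex ?r ?q) = 1" "cmod (Complex ?r (- ?q)) = 1"
    unfolding complex_norm power2_minus q by simp_all
  then have "cmod (Complex ?r ?q * e) = 1" "cmod (Complex ?r (- ?q) * e) = 1"
    by (simp_all only: norm_mult e(1))
  moreover have "z = (Complex ?r ?q * e + Complex ?r (- ?q) * e) / 2"
  proof -
    have "Complex ?r ?q + Complex ?r (- ?q) = 2 * complex_of_real ?r" by (simp add: complex_eq_iff)
    then have "(Complex ?r ?q * e + Complex ?r (- ?q) * e) / 2 = complex_of_real ?r * e"
      unfolding distrib_right[symmetric] by simp
    then show ?thesis using e(2) by metis
  qed
  ultimately show ?thesis by blast
qed

context
  fixes n :: nat and N :: "complex mat \<Rightarrow> real"
  assumes N: "unitarily_invariant_norm n N"
begin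

lemma uin_nonneg: "X \<in> carrier_mat n n \<Longrightarrow> 0 \<le> N X"
  and uin_eq_0_iff: "X \<in> carrier_mat n n \<Longrightarrow> N X = 0 \<longleftrightarrow> X = 0\<^sub>m n n"
  and uin_smult: "X \<in> carrier_mat n n \<Longrightarrow> N (c \<cdot>\<^sub>m X) = cmod c * N X"
  and uin_add: "X \<in> carrier_mat n n \<Longrightarrow> Y \<in> carrier_mat n n \<Longrightarrow> N (X + Y) \<le> N X + N Y"
  and uin_unitary: "unitary_mat n U \<Longrightarrow> unitary_mat n V \<Longrightarrow> X \<in> carrier_mat n n \<Longrightarrow> N (U * X * V) = N X"
  using N unfolding unitarily_invariant_norm_def by auto

lemma uin_average:
  assumes "X \<in> carrier_mat n n" "Y \<in> carrier_mat n n" "N X \<le> c" "N Y \<le> c"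
  shows "N ((1/2) \<cdot>\<^sub>m (X + Y)) \<le> c"
  using uin_add[of X Y] uin_smult[of "X + Y" "1/2"] assms by simp

lemma uin_unitary_left:
  assumes "unitary_mat n U" "X \<in> carrier_mat n n"
  shows "N (U * X) = N X"
  using uin_unitary[OF assms(1) _ assms(2), of "1\<^sub>m n"] assms by (auto simp: unitary_mat_def)

text \<open>The ratios of \<open>s\<close> to \<open>r\<close> lie in the unit disc, so each is a
  midpoint of two phases. Hence the smaller diagonal matrix is the average of two diagonal unitary
  multiples of the larger one.\<close>

lemma uin_diag_mono:
  assumes "\<And>i. i < n \<Longrightarrow> cmod (s i) \<le> cmod (r i)"
  shows "N (mat_diag n s) \<le> N (mat_diag n r)"
proof -
  have "\<exists>a b. cmod a = 1 \<and> cmod b = 1 \<and> s i = (a + b) / 2 * r i" if "i < n" for i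
  proof -
    \<comment> \<open>If \<open>r i = 0\<close>, the quotient is 0 by convention, and the hypothesis
      forces \<open>s i = 0\<close>, so any two phases will do.\<close>
    have "cmod (s i / r i) \<le> 1" using assms[OF that] by (auto simp: norm_divide divide_le_eq_1)
    from unit_disc_average[OF this] show ?thesis using assms[OF that]
      by (cases "r i = 0") (auto simp: divide_simps)
  qed
  then obtain a b where ab: "\<And>i. i < n \<Longrightarrow> cmod (a i) = 1" "\<And>i. i < n \<Longrightarrow> cmod (b i) = 1"
    "\<And>i. i < n \<Longrightarrow> s i = (a i + b i) / 2 * r i" by metis
  have "mat_diag n s = (1/2) \<cdot>\<^sub>m (mat_diag n a * mat_diag n r + mat_diag n b * mat_diag n r)"
    using ab(3) unfolding mat_diag_diag by (intro eq_matI) (auto simp: mat_diag_def field_simps)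
  also have "N \<dots> \<le> N (mat_diag n r)"
    using unitary_mat_diag[of n a] unitary_mat_diag[of n b] ab
    by (intro uin_average) (auto simp: uin_unitary_left simp del: mat_diag_diag
        intro!: mult_carrier_mat[of _ n n])
  finally show ?thesis .
qed

lemma uin_pinching:
  assumes Z: "Z \<in> carrier_mat n n"
  shows "N (mat_diag n (\<lambda>i. Z $$ (i, i))) \<le> N Z"
proof -
  \<comment> \<open>\<open>P k\<close> is \<open>Z\<close> with the off-diagonal entries removed
    from the rows and columns below index \<open>k\<close>; it interpolates between \<open>Z\<close>
    at 0 and its diagonal at \<open>n\<close>.\<close>
  define P where "P k = mat n n (\<lambda>(i, j). if i = j \<or> (k \<le> i \<and> k \<le> j) then Z $$ (i, j) else 0)" for k
  have Pc: "P k \<in> carrier_mat n n" for k by (simp add: P_def)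
  have "N (P k) \<le> N Z" for k
  proof (induction k)
    case 0
    have "P 0 = Z" using Z by (intro eq_matI) (auto simp: P_def)
    then show ?case by simp
  next
    case (Suc k)
    \<comment> \<open>Conjugation by this reflection flips exactly the off-diagonal entries of row
      and column \<open>k\<close>, so averaging with the conjugate erases them and keeps everything
      else.\<close>
    define e :: "nat \<Rightarrow> complex" where "e i = (if i = k then -1 else 1)" for i
    have E: "unitary_mat n (mat_diag n e)" by (rule unitary_mat_diag) (auto simp: e_def)
    have "mat_diag n e * P k * mat_diag n e = mat n n (\<lambda>(i, j). e i * P k $$ (i, j) * e j)"
      unfolding mat_diag_mult_left[OF Pc] by (subst mat_diag_mult_right[of _ n n]) auto
    then have "P (Suc k) = (1/2) \<cdot>\<^sub>m (P k + mat_diag n e * P k * mat_diag n e)"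
      by (intro eq_matI) (auto simp: P_def e_def)
    also have "N \<dots> \<le> N Z"
      using Suc.IH Pc uin_unitary[OF E E Pc] by (intro uin_average) (auto intro!: mult_carrier_mat[of _ n n])
    finally show ?case .
  qed
  moreover have "P n = mat_diag n (\<lambda>i. Z $$ (i, i))"
    by (intro eq_matI) (auto simp: P_def mat_diag_def)
  ultimately show ?thesis by metis
qed

lemma uin_diag_add: "N (mat_diag n (\<lambda>i. f i + g i)) \<le> N (mat_diag n f) + N (mat_diag n g)"
proof -
  have "mat_diag n (\<lambda>i. f i + g i) = mat_diag n f + mat_diag n g"
    by (intro eq_matI) (auto simp: mat_diag_def)
  then show ?thesis using uin_add[of "mat_diag n f" "mat_diag n g"] by simp
qed

lemma uin_diag_smult: "N (mat_diag n (\<lambda>i. c * f i)) = cmod c * N (mat_diag n f)"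
proof -
  have "mat_diag n (\<lambda>i. c * f i) = c \<cdot>\<^sub>m mat_diag n f"
    by (intro eq_matI) (auto simp: mat_diag_def)
  then show ?thesis using uin_smult[of "mat_diag n f" c] by simp
qed

text \<open>The numbers \<open>qform A (col V i)\<close> are the diagonal of \<open>V^* A V\<close>,
  which has the same norm as \<open>A\<close>; pinching discards the off-diagonal part.\<close>

lemma uin_diag_qform:
  assumes A: "A \<in> carrier_mat n n" and V: "unitary_mat n V"
  shows "N (mat_diag n (\<lambda>i. complex_of_real (cmod (qform A (col V i))))) \<le> N A"
proof -
  have Vc: "V \<in> carrier_mat n n" using V by (simp add: unitary_mat_def)
  let ?Z = "mat_adjoint V * A * V"
  have Z: "?Z \<in> carrier_mat n n" using A Vc mat_adjoint_carrier[OF Vc] by auto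
  have "N (mat_diag n (\<lambda>i. complex_of_real (cmod (qform A (col V i))))) \<le> N (mat_diag n (\<lambda>i. ?Z $$ (i, i)))"
    using adjoint_mult_mult_index[OF Vc Vc A] by (intro uin_diag_mono) (auto simp: qform_def)
  also have "\<dots> \<le> N ?Z" by (rule uin_pinching[OF Z])
  also have "\<dots> = N A" by (rule uin_unitary[OF unitary_mat_adjoint[OF V] V A])
  finally show ?thesis .
qed

text \<open>The hypothesis is used only at matching pairs of singular vectors. Each of
  \<open>A\<close> and \<open>B\<close> contributes two diagonals, one along \<open>V\<close> and
  one along \<open>U\<close>, which explains the factors 2.\<close>

lemma uin_le_of_sesquilinear_bound:
  assumes M: "M \<in> carrier_mat n n" "Determinant.det M \<noteq> 0"
    and A: "A \<in> carrier_mat n n" and B: "B \<in> carrier_mat n n"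
    and p: "0 \<le> p" and q: "0 \<le> q"
    and bound: "\<And>u v. u \<in> carrier_vec n \<Longrightarrow> v \<in> carrier_vec n \<Longrightarrow>
      cmod ((M *\<^sub>v v) \<bullet>c u) \<le> p * (cmod (qform A v) + cmod (qform A u))
        + q * (cmod (qform B v) + cmod (qform B u))"
  shows "N M \<le> 2 * p * N A + 2 * q * N B"
proof -
  obtain U V d where U: "unitary_mat n U" and V: "unitary_mat n V"
    and d: "mat_adjoint U * M * V = mat_diag n d"
    using singular_value_decomposition[OF M] by blast
  have Uc: "U \<in> carrier_mat n n" and Vc: "V \<in> carrier_mat n n"
    using U V by (auto simp: unitary_mat_def)
  define D where "D X W = mat_diag n (\<lambda>i. complex_of_real (cmod (qform X (col W i))))"
    for X W :: "complex mat"
  have "N M = N (mat_diag n d)"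
    using uin_unitary[OF unitary_mat_adjoint[OF U] V M(1)] d by simp
  also have "\<dots> \<le> N (mat_diag n (\<lambda>i.
      complex_of_real p * (complex_of_real (cmod (qform A (col V i))) + complex_of_real (cmod (qform A (col U i))))
    + complex_of_real q * (complex_of_real (cmod (qform B (col V i))) + complex_of_real (cmod (qform B (col U i))))))"
  proof (rule uin_diag_mono)
    fix i assume i: "i < n"
    have "d i = (M *\<^sub>v col V i) \<bullet>c col U i"
      using adjoint_mult_mult_index[OF Uc Vc M(1) i i] i unfolding d by (simp add: mat_diag_def)
    then have "cmod (d i) \<le> p * (cmod (qform A (col V i)) + cmod (qform A (col U i)))
        + q * (cmod (qform B (col V i)) + cmod (qform B (col U i)))"
      using bound[of "col U i" "col V i"] Uc Vc i by auto
    also have "\<dots> \<le> cmod (complex_of_real \<dots>)" unfolding norm_of_real by (rule abs_ge_self)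
    finally show "cmod (d i) \<le> cmod (complex_of_real p * (complex_of_real (cmod (qform A (col V i)))
        + complex_of_real (cmod (qform A (col U i)))) + complex_of_real q
        * (complex_of_real (cmod (qform B (col V i))) + complex_of_real (cmod (qform B (col U i)))))"
      by (simp only: of_real_add of_real_mult)
  qed
  also have "\<dots> \<le> p * (N (D A V) + N (D A U)) + q * (N (D B V) + N (D B U))"
    unfolding D_def
    by (rule order.trans[OF uin_diag_add]) 
      (use p q in \<open>simp add: uin_diag_smult add_mono mult_left_mono uin_diag_add\<close>)
  also have "\<dots> \<le> p * (N A + N A) + q * (N B + N B)"
    unfolding D_def using p q uin_diag_qform A B U V by (intro add_mono mult_left_mono) auto
  finally show ?thesis by simp
qed

end

section \<open>Sectorial matrices\<close>

lemma qform_add_smult: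
  assumes X: "X \<in> carrier_mat n n" and v: "v \<in> carrier_vec n" and u: "u \<in> carrier_vec n"
  shows "qform X (v + c \<cdot>\<^sub>v u) = qform X v + complex_of_real ((cmod c)\<^sup>2) * qform X u
    + cnj c * ((X *\<^sub>v v) \<bullet>c u) + c * ((X *\<^sub>v u) \<bullet>c v)"
proof -
  have "X *\<^sub>v (v + c \<cdot>\<^sub>v u) = X *\<^sub>v v + c \<cdot>\<^sub>v (X *\<^sub>v u)"
    using assms by (simp add: mult_add_distrib_mat_vec mult_mat_vec)
  moreover have "X *\<^sub>v v \<in> carrier_vec n" "X *\<^sub>v u \<in> carrier_vec n" using assms by auto
  ultimately show ?thesis
    using v u unfolding qform_def
    by (simp add: cinner_add[of _ n] cinner_smult[of _ n] cmod_square algebra_simps del: of_real_power)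
qed

lemma qform_smult:
  assumes "X \<in> carrier_mat n n" "u \<in> carrier_vec n"
  shows "qform X (c \<cdot>\<^sub>v u) = complex_of_real ((cmod c)\<^sup>2) * qform X u"
proof -
  have "X *\<^sub>v u \<in> carrier_vec n" using assms by auto
  then show ?thesis using assms unfolding qform_def
    by (simp add: mult_mat_vec cinner_smult[of _ n] cmod_square del: of_real_power)
qed

text \<open>The homogeneous form of W(X) lying in the sector. Without the restriction to unit
  vectors it passes to inverses and convex combinations with no rescaling. Strict positivity is
  stated apart because the form vanishes at 0.\<close>

definition sectorial :: "nat \<Rightarrow> real \<Rightarrow> complex mat \<Rightarrow> bool" where
  "sectorial n \<alpha> X \<longleftrightarrow> X \<in> carrier_mat n n \<and>
     (\<forall>x\<in>carrier_vec n. \<bar>Im (qform X x)\<bar> \<le> tan \<alpha> * Re (qform X x) \<and>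
       (x \<noteq> 0\<^sub>v n \<longrightarrow> 0 < Re (qform X x)))"

lemma sectorial_carrier: "sectorial n \<alpha> X \<Longrightarrow> X \<in> carrier_mat n n"
  and sectorial_Im: "sectorial n \<alpha> X \<Longrightarrow> x \<in> carrier_vec n \<Longrightarrow>
    \<bar>Im (qform X x)\<bar> \<le> tan \<alpha> * Re (qform X x)"
  and sectorial_pos: "sectorial n \<alpha> X \<Longrightarrow> x \<in> carrier_vec n \<Longrightarrow> x \<noteq> 0\<^sub>v n \<Longrightarrow> 0 < Re (qform X x)"
  by (auto simp: sectorial_def)

lemma sectorial_nonneg:
  assumes "sectorial n \<alpha> X" "x \<in> carrier_vec n"
  shows "0 \<le> Re (qform X x)"
proof (cases "x = 0\<^sub>v n")
  case True
  then show ?thesis using sectorial_carrier[OF assms(1)] by (simp add: qform_def)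
next
  case False
  then show ?thesis using sectorial_pos[OF assms] by simp
qed

lemma sectorial_num_range:
  assumes X: "X \<in> carrier_mat n n" and W: "num_range n X \<subseteq> sector \<alpha>"
  shows "sectorial n \<alpha> X"
  unfolding sectorial_def
proof (rule conjI[OF X], rule ballI)
  fix x :: "complex vec" assume x: "x \<in> carrier_vec n"
  have *: "\<exists>r>0. \<exists>z\<in>sector \<alpha>. qform X x = complex_of_real r * z" if x0: "x \<noteq> 0\<^sub>v n"
  proof -
    obtain r where r: "r > 0" "x \<bullet>c x = complex_of_real r" using cinner_self_pos[OF x x0] by blast
    let ?y = "complex_of_real (1 / sqrt r) \<cdot>\<^sub>v x"
    have "?y \<bullet>c ?y = complex_of_real (1 / sqrt r) * (complex_of_real (1 / sqrt r) * (x \<bullet>c x))"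
      using x by (simp add: cinner_smult[of _ n])
    also have "\<dots> = complex_of_real (1 / sqrt r * (1 / sqrt r) * r)"
      by (simp only: r(2) of_real_mult mult.assoc)
    also have "1 / sqrt r * (1 / sqrt r) * r = 1" using r by (simp add: field_simps)
    finally have "?y \<bullet>c ?y = 1" by simp
    moreover have "?y \<in> carrier_vec n" using x by simp
    ultimately have "qform X ?y \<in> sector \<alpha>"
      using W unfolding num_range_def by blast
    moreover have "(cmod (complex_of_real (1 / sqrt r)))\<^sup>2 = 1 / r"
      using r by (simp add: norm_divide power_divide)
    then have "qform X x = complex_of_real r * qform X ?y"
      using r by (simp only: qform_smult[OF X x]) simp
    ultimately show ?thesis using r by blast
  qed
  show "\<bar>Im (qform X x)\<bar> \<le> tan \<alpha> * Re (qform X x) \<and> (x \<noteq> 0\<^sub>v n \<longrightarrow> 0 < Re (qform X x))"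
  proof (cases "x = 0\<^sub>v n")
    case True
    then show ?thesis using X by (simp add: qform_def)
  next
    case False
    from *[OF False] obtain r z where rz: "r > 0" "z \<in> sector \<alpha>" "qform X x = complex_of_real r * z"
      by blast
    have "r * \<bar>Im z\<bar> \<le> r * (tan \<alpha> * Re z)"
      using rz by (intro mult_left_mono) (auto simp: sector_def)
    then show ?thesis using rz by (auto simp: sector_def abs_mult mult_ac)
  qed
qed

text \<open>The cross terms \<open><X v, u>\<close> and \<open><X u, v>\<close> need not be
  conjugate, so one choice of phase does not isolate the first. The sector is an intersection of two
  half-planes; adding their inequalities at two differently phased combinations of \<open>v\<close>
  and \<open>u\<close> removes the second cross term.\<close>

lemma sectorial_cauchy_schwarz:
  assumes X: "sectorial n \<alpha> X" and \<alpha>: "0 \<le> \<alpha>" "\<alpha> < pi / 2"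
    and v: "v \<in> carrier_vec n" and u: "u \<in> carrier_vec n"
  shows "2 * cos \<alpha> * cmod ((X *\<^sub>v v) \<bullet>c u) \<le> Re (qform X v) + Re (qform X u)"
proof -
  define z z' where "z = (X *\<^sub>v v) \<bullet>c u" and "z' = (X *\<^sub>v u) \<bullet>c v"
  \<comment> \<open>The phase of \<open>z\<close>. As \<open>sgn 0 = 0\<close>, the value 1 is used
    there to keep \<open>s\<close> on the unit circle.\<close>
  define s where "s = (if z = 0 then 1 else sgn z)"
  have s: "cmod s = 1" "cnj s * z = complex_of_real (cmod z)"
  proof -
    show "cmod s = 1" by (auto simp: s_def norm_sgn)
    have "cnj (sgn z) * z = complex_of_real (cmod z)" if "z \<noteq> 0"
      using that cmod_square[of z] by (simp add: sgn_eq field_simps power2_eq_square)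
    then show "cnj s * z = complex_of_real (cmod z)" by (auto simp: s_def)
  qed
  note Xc = sectorial_carrier[OF X]
  have q: "qform X (v + e \<cdot>\<^sub>v u) = qform X v + qform X u + cnj e * z + e * z'" if "cmod e = 1" for e
    using qform_add_smult[OF Xc v u, of e] that by (simp add: z_def z'_def)
  have c: "v + e \<cdot>\<^sub>v u \<in> carrier_vec n" for e using u v by auto
  \<comment> \<open>The rotation argument ends with a division by sin \<alpha>, so \<alpha> = 0 is
    separate. There the form is real, which makes the cross terms conjugate, and the classical
    argument at \<open>v - s u\<close> applies.\<close>
  show ?thesis
  proof (cases "\<alpha> = 0")
    case True
    have Im0: "Im (qform X x) = 0" if "x \<in> carrier_vec n" for x
      using sectorial_Im[OF X that] True by simp
    have "Im (z + z') = 0" using q[of 1] Im0[OF c, of 1] Im0[OF u] Im0[OF v] by simp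
    moreover have "Re z = Re z'" using q[of \<i>] Im0[OF c, of \<i>] Im0[OF u] Im0[OF v] by simp
    ultimately have "z' = cnj z" by (simp add: complex_eq_iff)
    then have "s * z' = complex_of_real (cmod z)" using arg_cong[OF s(2), of cnj] by simp
    then have eq: "cnj (- s) * z + (- s) * z' = - complex_of_real (2 * cmod z)"
      using s(2) by simp
    have "qform X (v + (- s) \<cdot>\<^sub>v u) = qform X v + qform X u + (cnj (- s) * z + (- s) * z')"
      using q[of "- s"] s(1) by simp
    then have "Re (qform X (v + (- s) \<cdot>\<^sub>v u)) = Re (qform X v) + Re (qform X u) - 2 * cmod z"
      unfolding eq by simp
    with sectorial_nonneg[OF X c, of "- s"] True show ?thesis by (simp add: z_def)
  next
    case False
    have sc: "sin \<alpha> > 0" "cos \<alpha> > 0" using False \<alpha> by (auto intro: sin_gt_zero cos_gt_zero)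
    have rot: "cos \<alpha> * \<bar>Im (qform X x)\<bar> \<le> sin \<alpha> * Re (qform X x)" if "x \<in> carrier_vec n" for x
      using mult_left_mono[OF sectorial_Im[OF X that], of "cos \<alpha>"] sc by (simp add: tan_def)
    \<comment> \<open>Multiplication by \<open>w\<close> turns the lower edge of the sector onto the
      imaginary axis, and multiplication by \<open>cnj w\<close> the upper edge; the sector
      condition becomes nonnegativity of both rotated real parts.\<close>
    define w where "w = Complex (sin \<alpha>) (- cos \<alpha>)"
    have w: "cmod w = 1" by (simp add: w_def cmod_def)
    have 1: "0 \<le> Re (w * qform X x)" "0 \<le> Re (cnj w * qform X x)" if "x \<in> carrier_vec n" for x
    proof -
      have "\<bar>cos \<alpha> * Im (qform X x)\<bar> \<le> sin \<alpha> * Re (qform X x)"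
        using rot[OF that] sc by (simp add: abs_mult)
      then show "0 \<le> Re (w * qform X x)" "0 \<le> Re (cnj w * qform X x)"
        by (simp_all add: w_def)
    qed
    \<comment> \<open>With these phases the two contributions of \<open>z'\<close> cancel.\<close>
    let ?e1 = "\<i> * cnj w * s" and ?e2 = "- \<i> * w * s"
    have ww: "w * cnj w = 1" using w by (simp add: complex_norm_square[symmetric])
    have q1: "qform X (v + ?e1 \<cdot>\<^sub>v u) = qform X v + qform X u + (- \<i> * w * cnj s) * z + ?e1 * z'"
      using q[of ?e1] w s(1) by (simp add: norm_mult)
    have q2: "qform X (v + ?e2 \<cdot>\<^sub>v u) = qform X v + qform X u + (\<i> * cnj w * cnj s) * z + ?e2 * z'"
      using q[of ?e2] w s(1) by (simp add: norm_mult)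
    have r1: "w * qform X (v + ?e1 \<cdot>\<^sub>v u) = w * (qform X v + qform X u)
        + (- \<i> * w\<^sup>2) * (cnj s * z) + \<i> * (w * cnj w) * s * z'"
      unfolding q1 by (simp add: algebra_simps power2_eq_square)
    have r2: "cnj w * qform X (v + ?e2 \<cdot>\<^sub>v u) = cnj w * (qform X v + qform X u)
        + (\<i> * (cnj w)\<^sup>2) * (cnj s * z) - \<i> * (w * cnj w) * s * z'"
      unfolding q2 by (simp add: algebra_simps power2_eq_square)
    have "w * qform X (v + ?e1 \<cdot>\<^sub>v u) + cnj w * qform X (v + ?e2 \<cdot>\<^sub>v u)
        = (w + cnj w) * (qform X v + qform X u) + \<i> * ((cnj w)\<^sup>2 - w\<^sup>2) * complex_of_real (cmod z)"
      unfolding r1 r2 s(2) ww by (simp add: algebra_simps)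
    also have "w + cnj w = complex_of_real (2 * sin \<alpha>)"
      by (simp add: w_def complex_eq_iff)
    also have "\<i> * ((cnj w)\<^sup>2 - w\<^sup>2) = - complex_of_real (4 * sin \<alpha> * cos \<alpha>)"
      by (simp add: w_def complex_eq_iff power2_eq_square)
    finally have "Re (w * qform X (v + ?e1 \<cdot>\<^sub>v u)) + Re (cnj w * qform X (v + ?e2 \<cdot>\<^sub>v u))
        = 2 * sin \<alpha> * (Re (qform X v) + Re (qform X u)) - 4 * sin \<alpha> * cos \<alpha> * cmod z"
      by (simp add: complex_eq_iff)
    then have "0 \<le> 2 * sin \<alpha> * (Re (qform X v) + Re (qform X u)) - 4 * sin \<alpha> * cos \<alpha> * cmod z"
      using 1(1)[OF c, of ?e1] 1(2)[OF c, of ?e2] by linarith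
    also have "\<dots> = (2 * sin \<alpha>) * (Re (qform X v) + Re (qform X u) - 2 * cos \<alpha> * cmod z)"
      by (simp add: algebra_simps)
    finally show ?thesis using sc by (simp add: zero_le_mult_iff z_def)
  qed
qed

section \<open>Inverses and weighted harmonic means of sectorial matrices\<close>

lemma sectorial_det_nonzero:
  assumes "sectorial n \<alpha> X"
  shows "Determinant.det X \<noteq> 0"
proof
  assume "Determinant.det X = 0"
  then obtain v where v: "v \<in> carrier_vec n" "v \<noteq> 0\<^sub>v n" "X *\<^sub>v v = 0\<^sub>v n"
    using det_0_iff_vec_prod_zero_field[OF sectorial_carrier[OF assms]] by auto
  then have "qform X v = 0" by (simp add: qform_def)
  with sectorial_pos[OF assms v(1,2)] show False by simp
qed

text \<open>The adjugate provides the witness that makes the choice in \<open>cinv\<close>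
  meaningful, and uniqueness of inverses identifies the two. The explicit formula later yields
  measurability of the harmonic mean in \<open>t\<close>.\<close>

lemma cinv_eq_adj:
  assumes X: "X \<in> carrier_mat n n" and det: "Determinant.det X \<noteq> 0"
  shows "cinv n X = (1 / Determinant.det X) \<cdot>\<^sub>m adj_mat X"
    and "X * cinv n X = 1\<^sub>m n" and "cinv n X * X = 1\<^sub>m n" and "cinv n X \<in> carrier_mat n n"
proof -
  let ?Y = "(1 / Determinant.det X) \<cdot>\<^sub>m adj_mat X"
  note adj = adj_mat[OF X]
  have Y: "?Y \<in> carrier_mat n n" using adj(1) by simp
  have "X * ?Y = (1 / Determinant.det X) \<cdot>\<^sub>m (Determinant.det X \<cdot>\<^sub>m 1\<^sub>m n)"
    by (simp only: mult_smult_distrib[OF X adj(1)] adj(2))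
  also have "\<dots> = 1\<^sub>m n" using det by (intro eq_matI) auto
  finally have XY: "X * ?Y = 1\<^sub>m n" .
  then have "?Y * X = 1\<^sub>m n" by (rule mat_mult_left_right_inverse[OF X Y])
  then have "\<exists>B. B \<in> carrier_mat n n \<and> X * B = 1\<^sub>m n \<and> B * X = 1\<^sub>m n"
    using Y XY by blast
  from someI_ex[OF this] have *: "cinv n X \<in> carrier_mat n n \<and> X * cinv n X = 1\<^sub>m n \<and> cinv n X * X = 1\<^sub>m n"
    unfolding cinv_def .
  then show "X * cinv n X = 1\<^sub>m n" "cinv n X * X = 1\<^sub>m n" "cinv n X \<in> carrier_mat n n" by auto
  have "cinv n X = cinv n X * (X * ?Y)" unfolding XY using * right_mult_one_mat[of "cinv n X" n n] by simp
  also have "\<dots> = cinv n X * X * ?Y"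
    using * by (intro assoc_mult_mat[symmetric, OF _ X Y]) blast
  also have "\<dots> = ?Y" using * left_mult_one_mat[OF Y] by simp
  finally show "cinv n X = ?Y" .
qed

text \<open>Substituting x = X y, the form of the inverse at x is the complex conjugate of the form
  of \<open>X\<close> at y, and the sector is symmetric under conjugation.\<close>

lemma sectorial_cinv:
  assumes X: "sectorial n \<alpha> X"
  shows "sectorial n \<alpha> (cinv n X)"
proof -
  note Xc = sectorial_carrier[OF X]
  note I = cinv_eq_adj[OF Xc sectorial_det_nonzero[OF X]]
  have q: "qform (cinv n X) x = cnj (qform X (cinv n X *\<^sub>v x))" if x: "x \<in> carrier_vec n" for x
  proof -
    have c: "cinv n X *\<^sub>v x \<in> carrier_vec n" using I x by auto
    have "X *\<^sub>v (cinv n X *\<^sub>v x) = x"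
      using assoc_mult_mat_vec[OF Xc I(4) x] I(2) x by simp
    then show ?thesis unfolding qform_def using cinner_commute[OF x c] by simp
  qed
  have nz: "cinv n X *\<^sub>v x \<noteq> 0\<^sub>v n" if "x \<in> carrier_vec n" "x \<noteq> 0\<^sub>v n" for x
  proof
    assume "cinv n X *\<^sub>v x = 0\<^sub>v n"
    moreover have "X *\<^sub>v (cinv n X *\<^sub>v x) = x"
      using assoc_mult_mat_vec[OF Xc I(4) that(1)] I(2) that(1) by simp
    ultimately show False using that Xc by auto
  qed
  show ?thesis unfolding sectorial_def
  proof (rule conjI[OF I(4)], intro ballI conjI impI)
    fix x :: "complex vec" assume x: "x \<in> carrier_vec n"
    have y: "cinv n X *\<^sub>v x \<in> carrier_vec n" using I(4) x by auto
    show "\<bar>Im (qform (cinv n X) x)\<bar> \<le> tan \<alpha> * Re (qform (cinv n X) x)"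
      using sectorial_Im[OF X y] by (simp only: q[OF x] cnj.sel abs_minus_cancel)
    assume "x \<noteq> 0\<^sub>v n"
    from sectorial_pos[OF X y nz[OF x this]]
    show "0 < Re (qform (cinv n X) x)" by (simp only: q[OF x] cnj.sel)
  qed
qed

lemma smult_mult_mat_vec:
  fixes X :: "complex mat"
  assumes "X \<in> carrier_mat n m" "v \<in> carrier_vec m"
  shows "(c \<cdot>\<^sub>m X) *\<^sub>v v = c \<cdot>\<^sub>v (X *\<^sub>v v)"
  using assms by (intro eq_vecI) (auto simp: scalar_prod_def sum_distrib_left mult.assoc)

lemma qform_combination:
  assumes "X \<in> carrier_mat n n" "Y \<in> carrier_mat n n" "x \<in> carrier_vec n"
  shows "qform (a \<cdot>\<^sub>m X + b \<cdot>\<^sub>m Y) x = a * qform X x + b * qform Y x"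
proof -
  have "(a \<cdot>\<^sub>m X + b \<cdot>\<^sub>m Y) *\<^sub>v x = a \<cdot>\<^sub>v (X *\<^sub>v x) + b \<cdot>\<^sub>v (Y *\<^sub>v x)"
    using assms by (simp add: add_mult_distrib_mat_vec[of _ n n] smult_mult_mat_vec[of _ n n])
  moreover have "X *\<^sub>v x \<in> carrier_vec n" "Y *\<^sub>v x \<in> carrier_vec n" using assms by auto
  ultimately show ?thesis unfolding qform_def
    using assms by (simp add: cinner_add[of _ n] cinner_smult[of _ n])
qed

lemma sectorial_convex:
  assumes X: "sectorial n \<alpha> X" and Y: "sectorial n \<alpha> Y" and t: "0 \<le> t" "t \<le> 1"
  shows "sectorial n \<alpha> (complex_of_real (1 - t) \<cdot>\<^sub>m X + complex_of_real t \<cdot>\<^sub>m Y)" (is "sectorial n \<alpha> ?Z")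
  unfolding sectorial_def
proof (intro conjI ballI impI)
  note Xc = sectorial_carrier[OF X] and Yc = sectorial_carrier[OF Y]
  show "?Z \<in> carrier_mat n n" using Xc Yc by auto
  fix x :: "complex vec" assume x: "x \<in> carrier_vec n"
  have Re: "Re (qform ?Z x) = (1 - t) * Re (qform X x) + t * Re (qform Y x)"
    and Im: "Im (qform ?Z x) = (1 - t) * Im (qform X x) + t * Im (qform Y x)"
    using qform_combination[OF Xc Yc x] by auto
  have "\<bar>Im (qform ?Z x)\<bar> \<le> (1 - t) * \<bar>Im (qform X x)\<bar> + t * \<bar>Im (qform Y x)\<bar>"
    unfolding Im by (rule order.trans[OF abs_triangle_ineq]) (use t in \<open>simp add: abs_mult\<close>)
  also have "\<dots> \<le> (1 - t) * (tan \<alpha> * Re (qform X x)) + t * (tan \<alpha> * Re (qform Y x))"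
    using t sectorial_Im[OF X x] sectorial_Im[OF Y x] by (intro add_mono mult_left_mono) auto
  finally show "\<bar>Im (qform ?Z x)\<bar> \<le> tan \<alpha> * Re (qform ?Z x)" unfolding Re by (simp add: algebra_simps)
  assume "x \<noteq> 0\<^sub>v n"
  then have "Re (qform X x) > 0" "Re (qform Y x) > 0" using sectorial_pos X Y x by auto
  then have "0 < (1 - t) * Re (qform X x) + t * Re (qform Y x)"
    using convex_bound_lt[of "- Re (qform X x)" 0 "- Re (qform Y x)" "1 - t" t] t by simp
  then show "0 < Re (qform ?Z x)" unfolding Re .
qed

lemma sectorial_wharm:
  assumes "sectorial n \<alpha> A" "sectorial n \<alpha> B" "0 \<le> t" "t \<le> 1"
  shows "sectorial n \<alpha> (wharm n t A B)"
  unfolding wharm_def using assms by (intro sectorial_cinv sectorial_convex)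

text \<open>The weights are those minimising \<open>s\<^sup>2 a / (1 - t) + (1 - s)\<^sup>2 b / t\<close> over \<open>s\<close>; the minimum
  is the scalar mean \<open>((1 - t) / a + t / b)\<^sup>-\<^sup>1\<close>.\<close>

lemma wharm_qform_le:
  assumes A: "sectorial n \<alpha> A" and B: "sectorial n \<alpha> B" and \<alpha>: "0 \<le> \<alpha>" "\<alpha> < pi / 2"
    and t: "0 \<le> t" "t \<le> 1" and ab: "a > 0" "b > 0" and x: "x \<in> carrier_vec n"
  defines "D \<equiv> t * a + (1 - t) * b"
  shows "Re (qform (wharm n t A B) x)
    \<le> (1 / cos \<alpha>)\<^sup>2 * ((1 - t) * (b / D)\<^sup>2 * Re (qform A x) + t * (a / D)\<^sup>2 * Re (qform B x))"
proof -
  define c where "c = 1 / cos \<alpha>"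
  have c: "c > 0" "cos \<alpha> * c = 1" using \<alpha> cos_gt_zero_pi[of \<alpha>] by (auto simp: c_def)
  have D: "D > 0" unfolding D_def using t ab
    by (cases "t = 0") (simp_all add: add_pos_nonneg)
  note Ac = sectorial_carrier[OF A] and Bc = sectorial_carrier[OF B]
  note IA = cinv_eq_adj[OF Ac sectorial_det_nonzero[OF A]]
  note IB = cinv_eq_adj[OF Bc sectorial_det_nonzero[OF B]]
  let ?K = "complex_of_real (1 - t) \<cdot>\<^sub>m cinv n A + complex_of_real t \<cdot>\<^sub>m cinv n B"
  have K: "sectorial n \<alpha> ?K" using A B t by (intro sectorial_convex sectorial_cinv)
  note Kc = sectorial_carrier[OF K]
  note IK = cinv_eq_adj[OF Kc sectorial_det_nonzero[OF K]]
  define w where "w = wharm n t A B *\<^sub>v x"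
  have w: "w \<in> carrier_vec n" unfolding w_def wharm_def using IK(4) x by auto
  \<comment> \<open>These split \<open>x\<close> as (1-t) p + t q with \<open>A p = B q = w\<close>,
    so the form of the mean at \<open>x\<close> becomes the weighted sum of the form of
    \<open>A\<close> at \<open>p\<close> and that of \<open>B\<close> at \<open>q\<close>.\<close>
  define p q where "p = cinv n A *\<^sub>v w" and "q = cinv n B *\<^sub>v w"
  have p: "p \<in> carrier_vec n" and q: "q \<in> carrier_vec n" using IA(4) IB(4) w by (auto simp: p_def q_def)
  have Ap: "A *\<^sub>v p = w"
    unfolding p_def using assoc_mult_mat_vec[OF Ac IA(4) w] IA(2) w by simp
  have Bq: "B *\<^sub>v q = w"
    unfolding q_def using assoc_mult_mat_vec[OF Bc IB(4) w] IB(2) w by simp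
  have "x = ?K *\<^sub>v w"
    unfolding w_def wharm_def using assoc_mult_mat_vec[OF Kc IK(4) x] IK(2) x by simp
  also have "\<dots> = complex_of_real (1 - t) \<cdot>\<^sub>v p + complex_of_real t \<cdot>\<^sub>v q"
    unfolding p_def q_def using IA(4) IB(4) w
    by (simp add: add_mult_distrib_mat_vec[of _ n n] smult_mult_mat_vec[of _ n n])
  finally have xpq: "x = complex_of_real (1 - t) \<cdot>\<^sub>v p + complex_of_real t \<cdot>\<^sub>v q" .
  have H: "qform (wharm n t A B) x = w \<bullet>c x" by (simp add: qform_def w_def)
  have "w \<bullet>c x = complex_of_real (1 - t) * (w \<bullet>c p) + complex_of_real t * (w \<bullet>c q)"
    using w p q unfolding xpq by (simp add: cinner_add[of _ n] cinner_smult[of _ n])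
  then have h: "Re (w \<bullet>c x) = (1 - t) * Re (qform A p) + t * Re (qform B q)"
    by (simp add: qform_def Ap Bq)
  \<comment> \<open>Cauchy-Schwarz against \<open>x\<close> scaled by \<open>k c\<close>: the factor
    \<open>c\<close> absorbs the cosine on the left and returns as \<open>c^2\<close> on the
    right.\<close>
  have young: "2 * k * Re (w \<bullet>c x) \<le> Re (qform X y) + k\<^sup>2 * (c\<^sup>2 * Re (qform X x))"
    if X: "sectorial n \<alpha> X" and y: "y \<in> carrier_vec n" "X *\<^sub>v y = w" and k: "k \<ge> 0" for X y k
  proof -
    let ?u = "complex_of_real (k * c) \<cdot>\<^sub>v x"
    have "2 * k * Re (w \<bullet>c x) \<le> 2 * k * cmod (w \<bullet>c x)"
      using k by (intro mult_left_mono complex_Re_le_cmod) auto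
    also have "\<dots> = 2 * (cos \<alpha> * c) * k * cmod (w \<bullet>c x)" using c by simp
    also have "\<dots> = 2 * cos \<alpha> * cmod ((X *\<^sub>v y) \<bullet>c ?u)"
      using w x y k c by (simp add: cinner_smult[of _ n] norm_mult)
    also have "\<dots> \<le> Re (qform X y) + Re (qform X ?u)"
      by (rule sectorial_cauchy_schwarz[OF X \<alpha> y(1)]) (use x in auto)
    also have "Re (qform X ?u) = k\<^sup>2 * (c\<^sup>2 * Re (qform X x))"
      using k c by (simp add: qform_smult[OF sectorial_carrier[OF X] x] norm_mult power_mult_distrib
          flip: of_real_power of_real_mult)
    finally show ?thesis .
  qed
  \<comment> \<open>Here s = (1-t) b/D and 1-s = t a/D. Keeping the factors 1-t and t outside avoids
    dividing by them, so the endpoints \<open>t = 0\<close> and \<open>t = 1\<close> are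
    covered.\<close>
  have "2 * Re (w \<bullet>c x) = (1 - t) * (2 * (b / D) * Re (w \<bullet>c x)) + t * (2 * (a / D) * Re (w \<bullet>c x))"
  proof -
    have "(1 - t) * (b / D) + t * (a / D) = (t * a + (1 - t) * b) / D"
      by (simp add: add_divide_distrib)
    also have "\<dots> = 1" unfolding D_def[symmetric] using D by simp
    finally have "2 * Re (w \<bullet>c x) = ((1 - t) * (b / D) + t * (a / D)) * (2 * Re (w \<bullet>c x))"
      by (simp only: mult_1)
    also have "\<dots> = (1 - t) * (2 * (b / D) * Re (w \<bullet>c x)) + t * (2 * (a / D) * Re (w \<bullet>c x))"
      by (simp only: distrib_left distrib_right mult_ac)
    finally show ?thesis .
  qed
  also have "\<dots> \<le> (1 - t) * (Re (qform A p) + (b / D)\<^sup>2 * (c\<^sup>2 * Re (qform A x)))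
      + t * (Re (qform B q) + (a / D)\<^sup>2 * (c\<^sup>2 * Re (qform B x)))"
    using t ab D by (intro add_mono mult_left_mono young[OF A p Ap] young[OF B q Bq]) auto
  \<comment> \<open>The forms at \<open>p\<close> and \<open>q\<close> recombine to the quantity
    being estimated, and one of its two copies on the left cancels.\<close>
  also have "\<dots> = Re (w \<bullet>c x) + c\<^sup>2 * ((1 - t) * (b / D)\<^sup>2 * Re (qform A x) + t * (a / D)\<^sup>2 * Re (qform B x))"
    unfolding h by (simp only: distrib_left mult_ac add_ac)
  finally have le: "2 * Re (w \<bullet>c x) \<le> Re (w \<bullet>c x) + c\<^sup>2 * ((1 - t) * (b / D)\<^sup>2 * Re (qform A x) + t * (a / D)\<^sup>2 * Re (qform B x))"
    .
  have "r \<le> y" if "2 * r \<le> r + y" for r y :: real using that by simp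
  from this[OF le] show ?thesis unfolding H c_def .
qed

text \<open>One secant comes from Cauchy-Schwarz for the mean, two from
  \<open>wharm_qform_le\<close>. Real parts are enlarged to moduli because moduli are what the
  diagonal norm estimate controls.\<close>

lemma wharm_sesquilinear_le:
  assumes A: "sectorial n \<alpha> A" and B: "sectorial n \<alpha> B" and \<alpha>: "0 \<le> \<alpha>" "\<alpha> < pi / 2"
    and t: "0 \<le> t" "t \<le> 1" and ab: "a > 0" "b > 0"
    and u: "u \<in> carrier_vec n" and v: "v \<in> carrier_vec n"
  defines "D \<equiv> t * a + (1 - t) * b"
  shows "cmod ((wharm n t A B *\<^sub>v v) \<bullet>c u) \<le> (1 / cos \<alpha>) ^ 3 / 2 *
    ((1 - t) * (b / D)\<^sup>2 * (cmod (qform A v) + cmod (qform A u))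
      + t * (a / D)\<^sup>2 * (cmod (qform B v) + cmod (qform B u)))"
proof -
  let ?H = "wharm n t A B"
  define c where "c = 1 / cos \<alpha>"
  have c: "c > 0" "cos \<alpha> = 1 / c" using \<alpha> cos_gt_zero_pi[of \<alpha>] by (auto simp: c_def)
  define p q where "p = (1 - t) * (b / D)\<^sup>2" and "q = t * (a / D)\<^sup>2"
  have bound: "Re (qform ?H x) \<le> c\<^sup>2 * (p * cmod (qform A x) + q * cmod (qform B x))"
    if "x \<in> carrier_vec n" for x
  proof -
    have "Re (qform ?H x) \<le> c\<^sup>2 * (p * Re (qform A x) + q * Re (qform B x))"
      unfolding c_def p_def q_def D_def by (rule wharm_qform_le[OF A B \<alpha> t ab that])
    also have "\<dots> \<le> c\<^sup>2 * (p * cmod (qform A x) + q * cmod (qform B x))"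
      unfolding p_def q_def
      using t by (intro mult_left_mono add_mono complex_Re_le_cmod) auto
    finally show ?thesis .
  qed
  have "cmod ((?H *\<^sub>v v) \<bullet>c u) = c / 2 * (2 * cos \<alpha> * cmod ((?H *\<^sub>v v) \<bullet>c u))"
    using c by simp
  also have "\<dots> \<le> c / 2 * (Re (qform ?H v) + Re (qform ?H u))"
    using c by (intro mult_left_mono sectorial_cauchy_schwarz[OF sectorial_wharm[OF A B t] \<alpha> v u]) auto
  also have "\<dots> \<le> c / 2 * (c\<^sup>2 * (p * cmod (qform A v) + q * cmod (qform B v))
      + c\<^sup>2 * (p * cmod (qform A u) + q * cmod (qform B u)))"
    using c bound[OF u] bound[OF v] by (intro mult_left_mono add_mono) auto
  also have "\<dots> = c ^ 3 / 2 * (p * (cmod (qform A v) + cmod (qform A u))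
      + q * (cmod (qform B v) + cmod (qform B u)))"
    by (simp add: distrib_left power2_eq_square power3_eq_cube mult_ac)
  finally show ?thesis unfolding c_def p_def q_def .
qed

section \<open>Integration over the weight\<close>

lemma borel_measurable_det:
  fixes M :: "'a \<Rightarrow> complex mat"
  assumes c: "\<And>t. M t \<in> carrier_mat n n"
    and m: "\<And>i j. i < n \<Longrightarrow> j < n \<Longrightarrow> (\<lambda>t. M t $$ (i, j)) \<in> borel_measurable S"
  shows "(\<lambda>t. Determinant.det (M t)) \<in> borel_measurable S"
  unfolding det_def'[OF c]
  by (intro borel_measurable_sum borel_measurable_times borel_measurable_const borel_measurable_prod m)
    (auto simp: permutes_in_image)

lemma borel_measurable_cofactor:
  fixes M :: "'a \<Rightarrow> complex mat"
  assumes c: "\<And>t. M t \<in> carrier_mat n n"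
    and m: "\<And>i j. i < n \<Longrightarrow> j < n \<Longrightarrow> (\<lambda>t. M t $$ (i, j)) \<in> borel_measurable S"
  shows "(\<lambda>t. cofactor (M t) i j) \<in> borel_measurable S"
proof -
  have d: "dim_row (M t) = n" "dim_col (M t) = n" for t using c[of t] by auto
  have "(\<lambda>t. Determinant.det (mat_delete (M t) i j)) \<in> borel_measurable S"
  proof (rule borel_measurable_det)
    show "mat_delete (M t) i j \<in> carrier_mat (n - 1) (n - 1)" for t
      using c by (rule mat_delete_carrier)
    fix i' j' assume ij: "i' < n - 1" "j' < n - 1"
    then show "(\<lambda>t. mat_delete (M t) i j $$ (i', j')) \<in> borel_measurable S"
      unfolding mat_delete_def d by (auto intro!: m)
  qed
  then show ?thesis unfolding cofactor_def by (intro borel_measurable_times borel_measurable_const)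
qed

context
  fixes \<nu> :: "real measure"
  assumes prob: "prob_space \<nu>" and sets_\<nu>: "sets \<nu> = sets (restrict_space borel {0..1::real})"
begin

interpretation prob_space \<nu> by (rule prob)

lemma space_unit_interval: "space \<nu> = {0..1}"
  using sets_eq_imp_space_eq[OF sets_\<nu>] by (simp add: space_restrict_space)

lemma borel_measurable_unit_interval:
  "f \<in> borel_measurable borel \<Longrightarrow> f \<in> borel_measurable \<nu>"
  by (subst measurable_cong_sets[OF sets_\<nu> refl]) (rule measurable_restrict_space1)

lemma integrable_unit_interval:
  fixes f :: "real \<Rightarrow> 'a::{banach, second_countable_topology}"
  assumes "f \<in> borel_measurable \<nu>" "\<And>t. 0 \<le> t \<Longrightarrow> t \<le> 1 \<Longrightarrow> norm (f t) \<le> K"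
  shows "integrable \<nu> f"
  using assms by (intro integrable_const_bound[of _ K]) (auto simp: space_unit_interval)

lemma integrable_wharm:
  assumes A: "sectorial n \<alpha> A" and B: "sectorial n \<alpha> B" and \<alpha>: "0 \<le> \<alpha>" "\<alpha> < pi / 2"
    and ij: "i < n" "j < n"
  shows "integrable \<nu> (\<lambda>t. wharm n t A B $$ (i, j))"
proof (rule integrable_unit_interval)
  let ?K = "\<lambda>t. complex_of_real (1 - t) \<cdot>\<^sub>m cinv n A + complex_of_real t \<cdot>\<^sub>m cinv n B"
  have Ai: "cinv n A \<in> carrier_mat n n" and Bi: "cinv n B \<in> carrier_mat n n"
    using sectorial_cinv[OF A] sectorial_cinv[OF B] by (auto simp: sectorial_def)
  have Kc: "?K t \<in> carrier_mat n n" for t using Ai Bi by auto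
  have "(\<lambda>t. ?K t $$ (k, l)) \<in> borel_measurable \<nu>" if "k < n" "l < n" for k l
  proof -
    have "(\<lambda>t. ?K t $$ (k, l))
        = (\<lambda>t. complex_of_real (1 - t) * cinv n A $$ (k, l) + complex_of_real t * cinv n B $$ (k, l))"
      using that Ai Bi by auto
    also have "\<dots> \<in> borel_measurable borel" by measurable
    finally show ?thesis by (rule borel_measurable_unit_interval)
  qed
  note meas = borel_measurable_det[OF Kc this] borel_measurable_cofactor[OF Kc this]
  have "(\<lambda>t. 1 / Determinant.det (?K t) * cofactor (?K t) j i) \<in> borel_measurable \<nu>"
    by (intro borel_measurable_times borel_measurable_divide borel_measurable_const meas)
  \<comment> \<open>The adjugate formula is claimed only on [0,1], where the combination is
    sectorial and hence invertible.\<close>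
  also have "?this \<longleftrightarrow> (\<lambda>t. wharm n t A B $$ (i, j)) \<in> borel_measurable \<nu>"
  proof (rule measurable_cong)
    fix t assume "t \<in> space \<nu>"
    then have "sectorial n \<alpha> (?K t)"
      using A B by (intro sectorial_convex sectorial_cinv) (auto simp: space_unit_interval)
    then have "wharm n t A B = (1 / Determinant.det (?K t)) \<cdot>\<^sub>m adj_mat (?K t)"
      unfolding wharm_def by (intro cinv_eq_adj(1) Kc sectorial_det_nonzero)
    then show "1 / Determinant.det (?K t) * cofactor (?K t) j i = wharm n t A B $$ (i, j)"
      using ij Ai Bi by (simp add: adj_mat_def)
  qed
  finally show "(\<lambda>t. wharm n t A B $$ (i, j)) \<in> borel_measurable \<nu>" .
  let ?a = "cmod (qform A (unit_vec n j)) + cmod (qform A (unit_vec n i))"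
  let ?b = "cmod (qform B (unit_vec n j)) + cmod (qform B (unit_vec n i))"
  fix t :: real assume t: "0 \<le> t" "t \<le> 1"
  have H: "wharm n t A B \<in> carrier_mat n n"
    using sectorial_wharm[OF A B t] by (rule sectorial_carrier)
  have "conjugate (unit_vec n i) = (unit_vec n i :: complex vec)"
    by (rule eq_vecI) (auto simp: unit_vec_def)
  then have "wharm n t A B $$ (i, j) = (wharm n t A B *\<^sub>v unit_vec n j) \<bullet>c unit_vec n i"
    using ij H by simp
  \<comment> \<open>With \<open>a = b = 1\<close> the denominator D is identically 1, so the
    sesquilinear bound at unit vectors is uniform in \<open>t\<close>.\<close>
  then have "norm (wharm n t A B $$ (i, j)) \<le> (1 / cos \<alpha>) ^ 3 / 2 * ((1 - t) * ?a + t * ?b)"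
    using wharm_sesquilinear_le[OF A B \<alpha> t, of 1 1 "unit_vec n i" "unit_vec n j"] by simp
  also have "\<dots> \<le> (1 / cos \<alpha>) ^ 3 / 2 * (1 * ?a + 1 * ?b)"
    using t \<alpha> cos_gt_zero_pi[of \<alpha>] by (intro mult_left_mono add_mono mult_right_mono) auto
  finally show "norm (wharm n t A B $$ (i, j)) \<le> (1 / cos \<alpha>) ^ 3 / 2 * (1 * ?a + 1 * ?b)" .
qed

text \<open>The entrywise integral commutes with the finite sum that defines the form; this reduces
  all later integration to scalar functions.\<close>

lemma msigma_cinner:
  assumes A: "sectorial n \<alpha> A" and B: "sectorial n \<alpha> B" and \<alpha>: "0 \<le> \<alpha>" "\<alpha> < pi / 2"
    and u: "u \<in> carrier_vec n" and v: "v \<in> carrier_vec n"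
  shows "integrable \<nu> (\<lambda>t. (wharm n t A B *\<^sub>v v) \<bullet>c u)" (is ?int)
    and "(msigma n \<nu> A B *\<^sub>v v) \<bullet>c u = (\<integral>t. (wharm n t A B *\<^sub>v v) \<bullet>c u \<partial>\<nu>)" (is ?eq)
proof -
  let ?g = "\<lambda>t. \<Sum>i<n. \<Sum>j<n. wharm n t A B $$ (i, j) * (v $ j * cnj (u $ i))"
  have g: "(wharm n t A B *\<^sub>v v) \<bullet>c u = ?g t" if "t \<in> space \<nu>" for t
    using that sectorial_carrier[OF sectorial_wharm[OF A B, of t]] u v
    by (intro cinner_mult_mat_vec_sum) (auto simp: space_unit_interval)
  have int: "integrable \<nu> (\<lambda>t. wharm n t A B $$ (i, j) * (v $ j * cnj (u $ i)))"
    if "i < n" "j < n" for i j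
    using integrable_wharm[OF A B \<alpha> that] by simp
  have "integrable \<nu> ?g" using int by (intro Bochner_Integration.integrable_sum) auto
  then show ?int using g by (simp cong: Bochner_Integration.integrable_cong)
  have "(msigma n \<nu> A B *\<^sub>v v) \<bullet>c u
      = (\<Sum>i<n. \<Sum>j<n. msigma n \<nu> A B $$ (i, j) * (v $ j * cnj (u $ i)))"
    by (rule cinner_mult_mat_vec_sum[OF _ v u]) (simp add: msigma_def)
  also have "\<dots> = (\<Sum>i<n. \<Sum>j<n. \<integral>t. wharm n t A B $$ (i, j) * (v $ j * cnj (u $ i)) \<partial>\<nu>)"
    by (intro sum.cong refl) (simp add: msigma_def)
  also have "\<dots> = (\<Sum>i<n. \<integral>t. (\<Sum>j<n. wharm n t A B $$ (i, j) * (v $ j * cnj (u $ i))) \<partial>\<nu>)"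
    by (intro sum.cong refl Bochner_Integration.integral_sum[symmetric] int) auto
  also have "\<dots> = (\<integral>t. ?g t \<partial>\<nu>)"
    by (intro Bochner_Integration.integral_sum[symmetric] Bochner_Integration.integrable_sum int) auto
  also have "\<dots> = (\<integral>t. (wharm n t A B *\<^sub>v v) \<bullet>c u \<partial>\<nu>)"
    using g by (intro Bochner_Integration.integral_cong) auto
  finally show ?eq .
qed

text \<open>At a kernel vector the form of the mean would be 0, yet it is the integral of a strictly
  positive real part against a measure of total mass 1. This is what admits the singular value
  decomposition.\<close>

lemma msigma_det_nonzero:
  assumes A: "sectorial n \<alpha> A" and B: "sectorial n \<alpha> B" and \<alpha>: "0 \<le> \<alpha>" "\<alpha> < pi / 2"
  shows "Determinant.det (msigma n \<nu> A B) \<noteq> 0"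
proof
  let ?M = "msigma n \<nu> A B"
  have Mc: "?M \<in> carrier_mat n n" by (simp add: msigma_def)
  assume "Determinant.det ?M = 0"
  then obtain x where x: "x \<in> carrier_vec n" "x \<noteq> 0\<^sub>v n" "?M *\<^sub>v x = 0\<^sub>v n"
    using det_0_iff_vec_prod_zero_field[OF Mc] by blast
  note int = msigma_cinner[OF A B \<alpha> x(1) x(1)]
  have "(\<integral>t. 0 \<partial>\<nu>) < (\<integral>t. Re (qform (wharm n t A B) x) \<partial>\<nu>)"
  proof (rule integral_less_AE_space)
    show "integrable \<nu> (\<lambda>t. Re (qform (wharm n t A B) x))"
      unfolding qform_def by (intro integrable_Re int)
    show "AE t in \<nu>. 0 < Re (qform (wharm n t A B) x)"
      using sectorial_pos[OF sectorial_wharm[OF A B] x(1,2)]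
      by (intro AE_I2) (auto simp: space_unit_interval)
  qed (auto simp: emeasure_space_1)
  also have "(\<integral>t. Re (qform (wharm n t A B) x) \<partial>\<nu>) = Re ((?M *\<^sub>v x) \<bullet>c x)"
    unfolding int(2) qform_def by (rule integral_Re[OF int(1)])
  finally show False using x by simp
qed

lemma msigma_uin_le:
  assumes A: "sectorial n \<alpha> A" and B: "sectorial n \<alpha> B" and \<alpha>: "0 \<le> \<alpha>" "\<alpha> < pi / 2"
    and N: "unitarily_invariant_norm n N" and ab: "N A > 0" "N B > 0"
  shows "N (msigma n \<nu> A B) \<le> (1 / cos \<alpha>) ^ 3 *
    (\<integral>t. N A * inverse ((1 - t) + t * inverse (N B / N A)) \<partial>\<nu>)"
proof -
  define a b where "a = N A" and "b = N B"
  note ab' = ab[folded a_def b_def]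
  define s where "s = (1 / cos \<alpha>) ^ 3 / 2"
  have s: "s > 0" using \<alpha> cos_gt_zero_pi[of \<alpha>] by (simp add: s_def)
  define D where "D t = t * a + (1 - t) * b" for t
  \<comment> \<open>A lower bound uniform in \<open>t\<close>, which makes the weights
    \<open>p\<close> and \<open>q\<close> bounded and hence integrable.\<close>
  have D_ge: "min a b \<le> D t" if "0 \<le> t" "t \<le> 1" for t
  proof -
    have "t * min a b + (1 - t) * min a b \<le> D t"
      unfolding D_def using that by (intro add_mono mult_left_mono) auto
    then show ?thesis by (simp add: algebra_simps)
  qed
  have D: "D t > 0" if "0 \<le> t" "t \<le> 1" for t
    using D_ge[OF that] ab' by linarith
  define p q where "p t = (1 - t) * (b / D t)\<^sup>2" and "q t = t * (a / D t)\<^sup>2" for t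
  have pq: "0 \<le> p t" "0 \<le> q t" if "0 \<le> t" "t \<le> 1" for t
    using that by (auto simp: p_def q_def)
  have int: "integrable \<nu> p" "integrable \<nu> q"
  proof -
    have "p \<in> borel_measurable borel" "q \<in> borel_measurable borel"
      unfolding p_def q_def D_def by measurable
    note meas = this[THEN borel_measurable_unit_interval]
    have bound: "norm (r * (k / D t)\<^sup>2) \<le> (k / min a b)\<^sup>2"
      if "0 \<le> t" "t \<le> 1" "0 \<le> r" "r \<le> 1" "k > 0" for t r k
    proof -
      have "r * (k / D t)\<^sup>2 \<le> 1 * (k / min a b)\<^sup>2"
        using that D_ge[OF that(1,2)] D[OF that(1,2)] ab'
        by (intro mult_mono power_mono divide_left_mono mult_pos_pos) auto
      then show ?thesis using that by simp
    qed
    show "integrable \<nu> p"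
      by (rule integrable_unit_interval[OF meas(1), of "(b / min a b)\<^sup>2"])
        (unfold p_def, rule bound, use ab' in auto)
    show "integrable \<nu> q"
      by (rule integrable_unit_interval[OF meas(2), of "(a / min a b)\<^sup>2"])
        (unfold q_def, rule bound, use ab' in auto)
  qed
  define P Q where "P = (\<integral>t. p t \<partial>\<nu>)" and "Q = (\<integral>t. q t \<partial>\<nu>)"
  have "P \<ge> 0" "Q \<ge> 0"
    unfolding P_def Q_def using pq by (auto intro!: integral_nonneg_AE AE_I2 simp: space_unit_interval)
  have "N (msigma n \<nu> A B) \<le> 2 * (s * P) * N A + 2 * (s * Q) * N B"
  proof (rule uin_le_of_sesquilinear_bound[OF N])
    show "msigma n \<nu> A B \<in> carrier_mat n n" by (simp add: msigma_def)
    show "Determinant.det (msigma n \<nu> A B) \<noteq> 0" by (rule msigma_det_nonzero[OF A B \<alpha>])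
    show "A \<in> carrier_mat n n" "B \<in> carrier_mat n n" using A B by (auto simp: sectorial_def)
    show "0 \<le> s * P" "0 \<le> s * Q" using s \<open>P \<ge> 0\<close> \<open>Q \<ge> 0\<close> by auto
    fix u v :: "complex vec" assume u: "u \<in> carrier_vec n" and v: "v \<in> carrier_vec n"
    let ?\<alpha> = "cmod (qform A v) + cmod (qform A u)" and ?\<beta> = "cmod (qform B v) + cmod (qform B u)"
    note mc = msigma_cinner[OF A B \<alpha> u v]
    have "cmod ((msigma n \<nu> A B *\<^sub>v v) \<bullet>c u) \<le> (\<integral>t. cmod ((wharm n t A B *\<^sub>v v) \<bullet>c u) \<partial>\<nu>)"
      unfolding mc(2) by (rule integral_norm_bound)
    also have "\<dots> \<le> (\<integral>t. s * (p t * ?\<alpha> + q t * ?\<beta>) \<partial>\<nu>)"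
    proof (rule integral_mono)
      show "integrable \<nu> (\<lambda>t. cmod ((wharm n t A B *\<^sub>v v) \<bullet>c u))" using mc(1) by simp
      show "integrable \<nu> (\<lambda>t. s * (p t * ?\<alpha> + q t * ?\<beta>))"
        using int by (intro integrable_mult_right Bochner_Integration.integrable_add integrable_mult_left)
      fix t assume "t \<in> space \<nu>"
      then show "cmod ((wharm n t A B *\<^sub>v v) \<bullet>c u) \<le> s * (p t * ?\<alpha> + q t * ?\<beta>)"
        unfolding s_def p_def q_def D_def
        by (intro wharm_sesquilinear_le[OF A B \<alpha> _ _ ab' u v]) (auto simp: space_unit_interval)
    qed
    also have "\<dots> = s * (P * ?\<alpha> + Q * ?\<beta>)"
    proof -
      have "(\<integral>t. p t * ?\<alpha> + q t * ?\<beta> \<partial>\<nu>) = P * ?\<alpha> + Q * ?\<beta>"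
        unfolding P_def Q_def using int
        by (subst Bochner_Integration.integral_add) (intro integrable_mult_left | simp)+
      then show ?thesis by simp
    qed
    finally show "cmod ((msigma n \<nu> A B *\<^sub>v v) \<bullet>c u) \<le> s * P * ?\<alpha> + s * Q * ?\<beta>"
      by (simp only: distrib_left mult.assoc)
  qed
  also have "\<dots> = 2 * s * (P * a + Q * b)"
    unfolding a_def b_def by (simp add: algebra_simps)
  also have "P * a + Q * b = (\<integral>t. p t * a + q t * b \<partial>\<nu>)"
    unfolding P_def Q_def using int
    by (subst Bochner_Integration.integral_add) (intro integrable_mult_left | simp)+
  also have "\<dots> = (\<integral>t. a * inverse ((1 - t) + t * inverse (b / a)) \<partial>\<nu>)"
  proof (intro Bochner_Integration.integral_cong refl)
    fix t assume "t \<in> space \<nu>"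
    then have Dt: "D t > 0" using D by (auto simp: space_unit_interval)
    have scalar: "(1 - t) + t * inverse (b / a) = D t / b"
      using ab' by (simp add: D_def field_simps)
    \<comment> \<open>The numerator is again \<open>D t\<close>, so one power cancels and ab/D, the
      scalar harmonic mean of \<open>a\<close> and \<open>b\<close>, appears with equality: nothing
      beyond the secants is lost.\<close>
    have "p t * a + q t * b = a * b * ((t * a + (1 - t) * b) / (D t)\<^sup>2)"
      by (simp add: p_def q_def power_divide power2_eq_square add_divide_distrib distrib_left mult_ac)
    also have "(t * a + (1 - t) * b) / (D t)\<^sup>2 = 1 / D t"
      unfolding D_def[symmetric] using Dt by (simp add: power2_eq_square)
    finally show "p t * a + q t * b = a * inverse ((1 - t) + t * inverse (b / a))"
      unfolding scalar by simp
  qed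
  finally show ?thesis unfolding s_def a_def b_def by simp
qed

end

theorem mainTheorem18:
  fixes n :: nat and A B :: "complex mat" and \<alpha> :: real
    and N :: "complex mat \<Rightarrow> real" and f :: "real \<Rightarrow> real" and \<nu> :: "real measure"
  assumes "accretive n A" and "accretive n B"
    and "0 \<le> \<alpha>" and "\<alpha> < pi / 2"
    and "num_range n A \<subseteq> sector \<alpha>" and "num_range n B \<subseteq> sector \<alpha>"
    and "unitarily_invariant_norm n N"
    and "f \<in> class_m" and "represents \<nu> f"
  shows "N (msigma n \<nu> A B) \<le> (1 / cos \<alpha>) ^ 3 * ssigma f (N A) (N B)"
proof -
  note \<alpha> = assms(3,4) and N = assms(7)
  have Ac: "A \<in> carrier_mat n n" and Bc: "B \<in> carrier_mat n n"
    using assms(1,2) by (auto simp: accretive_def)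
  have A: "sectorial n \<alpha> A" and B: "sectorial n \<alpha> B"
    using sectorial_num_range Ac Bc assms(5,6) by auto
  have \<nu>: "prob_space \<nu>" "sets \<nu> = sets (restrict_space borel {0..1})"
    and f: "\<And>x. x > 0 \<Longrightarrow> f x = (\<integral>t. inverse ((1 - t) + t * inverse x) \<partial>\<nu>)"
    using assms(9) by (auto simp: represents_def)
  show ?thesis
  \<comment> \<open>The weights require positive norms, which fails in dimension 0; there every
    matrix is the zero matrix and both sides vanish.\<close>
  proof (cases "n = 0")
    case True
    have "X = 0\<^sub>m n n" if "X \<in> carrier_mat n n" for X :: "complex mat"
      using that True by (intro eq_matI) auto
    then have "N X = 0" if "X \<in> carrier_mat n n" for X
      using that uin_eq_0_iff[OF N that] by blast
    then show ?thesis using Ac by (simp add: ssigma_def msigma_def)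
  next
    case False
    have pos: "N X > 0" if X: "sectorial n \<alpha> X" for X
    proof -
      have "X \<noteq> 0\<^sub>m n n"
      proof
        assume "X = 0\<^sub>m n n"
        then have "qform X (unit_vec n 0) = 0"
          unfolding qform_def by (subst cinner_mult_mat_vec_sum[of _ n n]) (auto intro!: sum.neutral)
        moreover have "unit_vec n 0 \<noteq> (0\<^sub>v n :: complex vec)"
          using False by (metis index_unit_vec(1) index_zero_vec(1) neq0_conv zero_neq_one)
        ultimately show False using sectorial_pos[OF X, of "unit_vec n 0"] by simp
      qed
      then show ?thesis
        using uin_nonneg[OF N] uin_eq_0_iff[OF N] sectorial_carrier[OF X] by (metis order_le_less)
    qed
    have "N (msigma n \<nu> A B) \<le> (1 / cos \<alpha>) ^ 3 *
        (\<integral>t. N A * inverse ((1 - t) + t * inverse (N B / N A)) \<partial>\<nu>)"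
      using msigma_uin_le[OF \<nu> A B \<alpha> N pos[OF A] pos[OF B]] .
    also have "(\<integral>t. N A * inverse ((1 - t) + t * inverse (N B / N A)) \<partial>\<nu>) = ssigma f (N A) (N B)"
      using f[of "N B / N A"] pos[OF A] pos[OF B] by (simp add: ssigma_def)
    finally show ?thesis .
  qed
qed

end
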